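(* Fix any norm $\|\cdot\|$ on $\mathbb{R}^d$. There is an online algorithm for nested convex body chasing in $(\mathbb{R}^d,\|\cdot\|)$ that is $O(d\log d)$-competitive.
   Context: Nested convex body chasing: an online algorithm is given a starting point $x_0\in\mathbb{R}^d$ and then, one at a time, convex bodies $K_1\supseteq K_2\supseteq K_3\supseteq\cdots$ in $\mathbb{R}^d$. Upon receiving $K_t$ (and before seeing $K_{t+1}$) it must output a point $x_t\in K_t$. Its cost on a sequence $K_1,\dots,K_T$ is the total movement $\sum_{t=1}^{T}\|x_t-x_{t-1}\|$. The optimal offline cost is $\mathrm{dist}(x_0,K_T)=\min_{x\in K_T}\|x_0-x\|$. An algorithm is $c$-competitive if for every starting point and every nested request sequence its cost is at most $c$ times the optimal offline cost (up to constant factors in the $O(\cdot)$ notation). *)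

theory Defs
  imports "HOL-Analysis.Analysis" "HOL-Library.Landau_Symbols"
begin

text \<open>
  The asymptotic constant has to be uniform in \<open>d\<close>, so the dimension must be a natural number inside
  the formula and not a type. \<open>\<real>\<^sup>d\<close> is therefore \<open>topspace (Euclidean_space d)\<close>, i.e. the functions
  \<open>x :: nat \<Rightarrow> real\<close> with \<open>x i = 0\<close> for all \<open>i \<ge> d\<close>.
\<close>

definition norm_on_Rd :: "nat \<Rightarrow> ((nat \<Rightarrow> real) \<Rightarrow> real) \<Rightarrow> bool" where
  "norm_on_Rd d N \<longleftrightarrow>
     (\<forall>x \<in> topspace (Euclidean_space d). 0 \<le> N x \<and> (N x = 0 \<longleftrightarrow> x = (\<lambda>i. 0))) \<and>
     (\<forall>c. \<forall>x \<in> topspace (Euclidean_space d). N (\<lambda>i. c * x i) = \<bar>c\<bar> * N x) \<and>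
     (\<forall>x \<in> topspace (Euclidean_space d). \<forall>y \<in> topspace (Euclidean_space d).
        N (\<lambda>i. x i + y i) \<le> N x + N y)"

definition convex_in_Rd :: "(nat \<Rightarrow> real) set \<Rightarrow> bool" where
  "convex_in_Rd K \<longleftrightarrow>
     (\<forall>x \<in> K. \<forall>y \<in> K. \<forall>u \<in> {0..1}. (\<lambda>i. (1 - u) * x i + u * y i) \<in> K)"

text \<open>
  As usual in the chasing literature, neither boundedness nor nonempty interior is required of a
  request. An algorithm that handles these requests handles in particular the compact ones and those
  with nonempty interior. In finite dimension all norms induce the same topology, so closedness
  refers to the Euclidean one.
\<close>

definition convex_body :: "nat \<Rightarrow> (nat \<Rightarrow> real) set \<Rightarrow> bool" where
  "convex_body d K \<longleftrightarrow> closedin (Euclidean_space d) K \<and> convex_in_Rd K \<and> K \<noteq> {}"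

definition nested_requests :: "nat \<Rightarrow> (nat \<Rightarrow> real) set list \<Rightarrow> bool" where
  "nested_requests d Ks \<longleftrightarrow>
     Ks \<noteq> [] \<and> (\<forall>K \<in> set Ks. convex_body d K) \<and>
     (\<forall>t. Suc t < length Ks \<longrightarrow> Ks ! Suc t \<subseteq> Ks ! t)"

text \<open>
  A (deterministic) online algorithm maps the starting point and the requests \<open>[K\<^sub>1, \<dots>, K\<^sub>t]\<close> revealed
  so far to \<open>x\<^sub>t\<close>; it cannot depend on later requests because it does not receive them.
\<close>

type_synonym chasing_algorithm = "(nat \<Rightarrow> real) \<Rightarrow> (nat \<Rightarrow> real) set list \<Rightarrow> (nat \<Rightarrow> real)"

definition online_algorithm :: "nat \<Rightarrow> chasing_algorithm \<Rightarrow> bool" where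
  "online_algorithm d A \<longleftrightarrow>
     (\<forall>x0 \<in> topspace (Euclidean_space d). \<forall>Ks. nested_requests d Ks \<longrightarrow> A x0 Ks \<in> last Ks)"

definition position ::
    "chasing_algorithm \<Rightarrow> (nat \<Rightarrow> real) \<Rightarrow> (nat \<Rightarrow> real) set list \<Rightarrow> nat \<Rightarrow> (nat \<Rightarrow> real)" where
  "position A x0 Ks t = (if t = 0 then x0 else A x0 (take t Ks))"

definition movement_cost ::
    "((nat \<Rightarrow> real) \<Rightarrow> real) \<Rightarrow> chasing_algorithm \<Rightarrow> (nat \<Rightarrow> real) \<Rightarrow> (nat \<Rightarrow> real) set list \<Rightarrow> real" where
  "movement_cost N A x0 Ks =
     (\<Sum>t = 1..length Ks. N (\<lambda>i. position A x0 Ks t i - position A x0 Ks (t - 1) i))"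

definition offline_cost ::
    "((nat \<Rightarrow> real) \<Rightarrow> real) \<Rightarrow> (nat \<Rightarrow> real) \<Rightarrow> (nat \<Rightarrow> real) set list \<Rightarrow> real" where
  "offline_cost N x0 Ks = (INF x \<in> last Ks. N (\<lambda>i. x0 i - x i))"

definition competitive ::
    "nat \<Rightarrow> ((nat \<Rightarrow> real) \<Rightarrow> real) \<Rightarrow> chasing_algorithm \<Rightarrow> real \<Rightarrow> bool" where
  "competitive d N A c \<longleftrightarrow>
     (\<forall>x0 \<in> topspace (Euclidean_space d). \<forall>Ks. nested_requests d Ks \<longrightarrow>
        movement_cost N A x0 Ks \<le> c * offline_cost N x0 Ks)"

end

theory Submission
  imports Defs
begin

text \<open>
  Let \<open>h\<^sub>K\<close> be the support function of \<open>K\<close>, \<open>D\<close> the dual norm and \<open>\<rho> = max 0 (1 - D)\<close>. The function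
  \<open>\<phi>\<^sub>K w = \<integral> h\<^sub>K (v + w) \<rho> v dv = \<integral> h\<^sub>K v \<rho> (v - w) dv\<close> is convex, and it is differentiable at \<open>0\<close> because
  \<open>\<rho>\<close> is concave on the dual unit ball. The generalised Steiner point \<open>s K = \<nabla>\<phi>\<^sub>K 0 / \<integral>\<rho>\<close> lies in \<open>K\<close>, since
  \<open>h\<^sub>K (v + w) \<le> h\<^sub>K v + h\<^sub>K w\<close>. As \<open>\<rho>\<close> is 1-Lipschitz for \<open>D\<close>, for \<open>L \<subseteq> K\<close> the distance of \<open>s L\<close> and
  \<open>s K\<close> is at most \<open>\<integral> (h\<^sub>K - h\<^sub>L) / \<integral>\<rho>\<close>, integrated over a slightly enlarged dual unit ball. This bound telescopes, so
  the total movement inside a ball of radius \<open>r\<close> is at most of order \<open>r vol B / \<integral>\<rho>\<close> for the dual unit ball \<open>B\<close>, hence \<open>O(d r)\<close>.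
  The algorithm plays the Steiner point of the request intersected with a ball around the starting point whose
  radius is the distance to the request rounded up to a power of two; the costs of the
  successive radii form a geometric series. The result is even \<open>O(d)\<close>-competitive.
\<close>

section \<open>Support functions and separation\<close>

abbreviation Rd :: "nat \<Rightarrow> (nat \<Rightarrow> real) set" where
  "Rd d \<equiv> topspace (Euclidean_space d)"

definition dot :: "nat \<Rightarrow> (nat \<Rightarrow> real) \<Rightarrow> (nat \<Rightarrow> real) \<Rightarrow> real" where
  "dot d v x = (\<Sum>i<d. v i * x i)"

lemma dot_add_left: "dot d (\<lambda>i. v i + w i) x = dot d v x + dot d w x"
  by (simp add: dot_def algebra_simps sum.distrib)

lemma dot_diff_right: "dot d v (\<lambda>i. x i - y i) = dot d v x - dot d v y"
  by (simp add: dot_def algebra_simps sum_subtractf)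

lemma dot_scale_left: "dot d (\<lambda>i. c * v i) x = c * dot d v x"
  by (simp add: dot_def sum_distrib_left algebra_simps)

lemma dot_scale_right: "dot d v (\<lambda>i. c * x i) = c * dot d v x"
  by (simp add: dot_def sum_distrib_left algebra_simps)

lemma dot_self_pos:
  assumes "z \<in> Rd d" "z \<noteq> (\<lambda>i. 0)"
  shows "dot d z z > 0"
proof -
  obtain i where i: "z i \<noteq> 0" "i < d"
    using assms by (force simp: topspace_Euclidean_space not_le)
  have "0 < z i * z i"
    using i not_square_less_zero[of "z i"] by (simp add: less_le)
  also have "z i * z i \<le> dot d z z"
    unfolding dot_def using i by (intro member_le_sum) auto
  finally show ?thesis .
qed

lemma abs_dot_le:
  assumes "\<And>i. i < d \<Longrightarrow> \<bar>x i\<bar> \<le> B"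
  shows "\<bar>dot d v x\<bar> \<le> B * (\<Sum>i<d. \<bar>v i\<bar>)"
proof -
  have "\<bar>dot d v x\<bar> \<le> (\<Sum>i<d. \<bar>v i * x i\<bar>)"
    unfolding dot_def by (rule sum_abs)
  also have "\<dots> \<le> (\<Sum>i<d. \<bar>v i\<bar> * B)"
    by (intro sum_mono) (simp add: abs_mult assms mult_left_mono)
  finally show ?thesis
    by (simp add: sum_distrib_left mult.commute)
qed

lemma continuous_on_dot_right: "continuous_on S (dot d v)"
  unfolding dot_def
  by (intro continuous_intros continuous_on_subset[OF continuous_on_product_coordinates]) auto

text \<open>The type \<open>nat \<Rightarrow> real\<close> carries the product topology, so a cube
  over all coordinates is compact by Tychonoff. The absolute value of \<open>B\<close> keeps
  \<open>0\<close> in every factor, which the vanishing coordinates from \<open>d\<close> on require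
  whatever the sign of \<open>B\<close>.\<close>

lemma compact_bounded_Rd:
  assumes "closed K" "K \<subseteq> Rd d" "\<And>x i. x \<in> K \<Longrightarrow> i < d \<Longrightarrow> \<bar>x i\<bar> \<le> B"
  shows "compact K"
proof -
  let ?P = "PiE UNIV (\<lambda>i::nat. {- \<bar>B\<bar>..\<bar>B\<bar>})"
  have "compactin (product_topology (\<lambda>i::nat. euclidean :: real topology) UNIV) ?P"
    unfolding compactin_PiE by simp
  then have "compact ?P"
    by (simp add: euclidean_product_topology)
  moreover have "K \<subseteq> ?P"
  proof
    fix x assume x: "x \<in> K"
    have "x i \<in> {- \<bar>B\<bar>..\<bar>B\<bar>}" for i
    proof (cases "i < d")
      case True
      then show ?thesis using assms(3)[OF x True] by auto
    next
      case False
      then show ?thesis using assms(2) x by (auto simp: topspace_Euclidean_space)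
    qed
    then show "x \<in> ?P" by auto
  qed
  ultimately show ?thesis
    using compact_Int_closed[OF _ assms(1), of ?P] by (simp add: Int_absorb1)
qed

text \<open>Only points at least as close to \<open>z\<close> as one fixed point of \<open>K\<close>
  can compete, and these form a compact set on which the squared Euclidean distance attains its
  minimum.\<close>

lemma closest_point_exists_Rd:
  assumes "closed K" "K \<subseteq> Rd d" "K \<noteq> {}"
  obtains y where "y \<in> K"
    "\<And>x. x \<in> K \<Longrightarrow> (\<Sum>i<d. (y i - z i)\<^sup>2) \<le> (\<Sum>i<d. (x i - z i)\<^sup>2)"
proof -
  let ?Q = "\<lambda>x. \<Sum>i<d. (x i - z i)\<^sup>2 :: real"
  obtain x1 where x1: "x1 \<in> K" using assms by auto
  have cont: "continuous_on S ?Q" for S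
    by (intro continuous_intros continuous_on_subset[OF continuous_on_product_coordinates]) auto
  define K' where "K' = K \<inter> {x. ?Q x \<le> ?Q x1}"
  have "closed K'"
    unfolding K'_def by (intro closed_Int assms closed_Collect_le cont continuous_intros)
  moreover have "\<bar>x i\<bar> \<le> sqrt (?Q x1) + (\<Sum>i<d. \<bar>z i\<bar>)" if "x \<in> K'" "i < d" for x i
  proof -
    have "(x i - z i)\<^sup>2 \<le> ?Q x"
      using that by (intro member_le_sum) auto
    also have "\<dots> \<le> ?Q x1" using that by (simp add: K'_def)
    finally have "\<bar>x i - z i\<bar> \<le> sqrt (?Q x1)"
      by (metis real_sqrt_abs real_sqrt_le_iff)
    moreover have "\<bar>z i\<bar> \<le> (\<Sum>i<d. \<bar>z i\<bar>)"
      using that by (intro member_le_sum) auto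
    ultimately show ?thesis by linarith
  qed
  ultimately have "compact K'"
    by (intro compact_bounded_Rd[of K' d]) (use assms in \<open>auto simp: K'_def\<close>)
  then obtain y where y: "y \<in> K'" "\<And>x. x \<in> K' \<Longrightarrow> ?Q y \<le> ?Q x"
    using continuous_attains_inf[of K' ?Q] x1 cont by (auto simp: K'_def)
  show thesis
  proof
    show "y \<in> K" using y by (simp add: K'_def)
    fix x assume "x \<in> K"
    then show "?Q y \<le> ?Q x"
      using y(2)[of x] y(1) by (cases "x \<in> K'") (auto simp: K'_def)
  qed
qed

text \<open>The separating hyperplane passes through the Euclidean nearest point \<open>y\<close> of
  \<open>K\<close> and is orthogonal to \<open>z - y\<close>.\<close>

lemma separation_Rd:
  assumes "closed K" "K \<subseteq> Rd d" "convex_in_Rd K" "K \<noteq> {}" "z \<in> Rd d" "z \<notin> K"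
  obtains w b where "\<And>x. x \<in> K \<Longrightarrow> dot d w x \<le> b" "b < dot d w z"
proof -
  obtain y where y: "y \<in> K"
    and ymin: "\<And>x. x \<in> K \<Longrightarrow> (\<Sum>i<d. (y i - z i)\<^sup>2) \<le> (\<Sum>i<d. (x i - z i)\<^sup>2)"
    using closest_point_exists_Rd[OF assms(1,2,4)] by blast
  define w where "w = (\<lambda>i. z i - y i)"
  have sq: "(\<Sum>i<d. (a i)\<^sup>2) = dot d a a" for a
    by (simp add: dot_def power2_eq_square)
  have le: "dot d w x \<le> dot d w y" if x: "x \<in> K" for x
  proof -
    define u where "u = (\<lambda>i. x i - y i)"
    \<comment> \<open>First-order optimality of \<open>y\<close>: moving a fraction \<open>t\<close>
      towards \<open>x\<close> cannot come closer to \<open>z\<close>. After division by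
      \<open>t\<close> the quadratic term disappears as \<open>t\<close> tends to
      \<open>0\<close>.\<close>
    have key: "2 * dot d w u \<le> t * dot d u u" if t: "0 < t" "t \<le> 1" for t
    proof -
      have "(\<lambda>i. (1 - t) * y i + t * x i) \<in> K"
        using assms(3) x y t unfolding convex_in_Rd_def by auto
      from ymin[OF this]
      have "dot d (\<lambda>i. y i - z i) (\<lambda>i. y i - z i) \<le>
          (\<Sum>i<d. ((1 - t) * y i + t * x i - z i)\<^sup>2)"
        by (simp add: sq)
      also have "\<dots> = dot d (\<lambda>i. y i - z i) (\<lambda>i. y i - z i) - 2 * t * dot d w u + t\<^sup>2 * dot d u u"
        unfolding dot_def w_def u_def
        by (simp add: sum_distrib_left flip: sum.distrib sum_subtractf)
           (intro sum.cong, auto simp: algebra_simps power2_eq_square)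
      finally have "t * (2 * dot d w u) \<le> t * (t * dot d u u)"
        by (simp add: algebra_simps power2_eq_square)
      then show ?thesis using t by simp
    qed
    have lim: "((\<lambda>t. t * dot d u u) \<longlongrightarrow> 0 * dot d u u) (at_right 0)"
      by (intro tendsto_intros)
    have "eventually (\<lambda>t::real. 0 < t \<and> t \<le> 1) (at_right 0)"
      using eventually_at_right_real[of 0 1] by (auto elim: eventually_mono)
    then have "2 * dot d w u \<le> 0 * dot d u u"
      by (intro tendsto_lowerbound[OF lim]) (auto elim!: eventually_mono intro: key)
    then show ?thesis by (simp add: u_def dot_diff_right)
  qed
  have "w \<in> Rd d" using assms(2,5) y by (auto simp: topspace_Euclidean_space w_def)
  moreover have "w \<noteq> (\<lambda>i. 0)"
  proof
    assume "w = (\<lambda>i. 0)"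
    then have "z = y" unfolding w_def by (metis (no_types, lifting) eq_iff_diff_eq_0 ext)
    then show False using assms y by simp
  qed
  ultimately have "0 < dot d w w" by (rule dot_self_pos)
  then have "dot d w y < dot d w z"
    using dot_diff_right[of d w z y] by (simp add: w_def)
  then show thesis using le that by blast
qed

text \<open>The support function of \<open>K\<close>. The supremum is over reals and so carries
  meaning only for nonempty \<open>K\<close> with bounded coordinates, hence the recurring pair of
  hypotheses on \<open>K\<close>.\<close>

definition supp :: "nat \<Rightarrow> (nat \<Rightarrow> real) set \<Rightarrow> (nat \<Rightarrow> real) \<Rightarrow> real" where
  "supp d K v = (SUP x\<in>K. dot d v x)"

definition bounded_Rd :: "nat \<Rightarrow> (nat \<Rightarrow> real) set \<Rightarrow> bool" where
  "bounded_Rd d K \<longleftrightarrow> (\<exists>B. \<forall>x\<in>K. \<forall>i<d. \<bar>x i\<bar> \<le> B)"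

lemma bounded_Rd_subset: "bounded_Rd d K \<Longrightarrow> L \<subseteq> K \<Longrightarrow> bounded_Rd d L"
  unfolding bounded_Rd_def by blast

lemma bdd_above_dot:
  assumes "bounded_Rd d K"
  shows "bdd_above (dot d v ` K)"
proof -
  obtain B where B: "\<And>x i. x \<in> K \<Longrightarrow> i < d \<Longrightarrow> \<bar>x i\<bar> \<le> B"
    using assms by (auto simp: bounded_Rd_def)
  show ?thesis
    by (rule bdd_aboveI2, rule order.trans[OF abs_ge_self abs_dot_le]) (rule B)
qed

lemma dot_le_supp: "bounded_Rd d K \<Longrightarrow> x \<in> K \<Longrightarrow> dot d v x \<le> supp d K v"
  unfolding supp_def by (intro cSUP_upper bdd_above_dot)

lemma supp_least: "K \<noteq> {} \<Longrightarrow> (\<And>x. x \<in> K \<Longrightarrow> dot d v x \<le> b) \<Longrightarrow> supp d K v \<le> b"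
  unfolding supp_def by (rule cSUP_least)

lemma supp_mono:
  "bounded_Rd d K \<Longrightarrow> L \<noteq> {} \<Longrightarrow> L \<subseteq> K \<Longrightarrow> supp d L v \<le> supp d K v"
  by (intro supp_least) (auto intro: dot_le_supp)

lemma supp_add_le:
  "bounded_Rd d K \<Longrightarrow> K \<noteq> {} \<Longrightarrow> supp d K (\<lambda>i. v i + w i) \<le> supp d K v + supp d K w"
  by (intro supp_least) (auto simp: dot_add_left intro!: add_mono dot_le_supp)

lemma supp_scale:
  assumes "bounded_Rd d K" "K \<noteq> {}" "c \<ge> 0"
  shows "supp d K (\<lambda>i. c * v i) = c * supp d K v"
proof (cases "c = 0")
  case True
  then show ?thesis using assms(2) by (simp add: supp_def dot_def)
next
  case False
  then have c: "c > 0" using assms by simp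
  show ?thesis
  proof (rule antisym)
    show "supp d K (\<lambda>i. c * v i) \<le> c * supp d K v"
      using assms by (intro supp_least) (auto simp: dot_scale_left intro!: mult_left_mono dot_le_supp)
    have "supp d K v \<le> supp d K (\<lambda>i. c * v i) / c"
    proof (intro supp_least assms)
      fix x assume "x \<in> K"
      then have "c * dot d v x \<le> supp d K (\<lambda>i. c * v i)"
        using dot_le_supp[OF assms(1), of x "\<lambda>i. c * v i"] by (simp add: dot_scale_left)
      then show "dot d v x \<le> supp d K (\<lambda>i. c * v i) / c"
        using c by (simp add: field_simps)
    qed
    then show "c * supp d K v \<le> supp d K (\<lambda>i. c * v i)"
      using c by (simp add: field_simps)
  qed
qed

lemma supp_cong: "(\<And>i. i < d \<Longrightarrow> v i = w i) \<Longrightarrow> supp d K v = supp d K w"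
  by (simp add: supp_def dot_def)

lemma supp_le_bound:
  assumes "K \<noteq> {}" "\<And>x i. x \<in> K \<Longrightarrow> i < d \<Longrightarrow> \<bar>x i\<bar> \<le> B"
  shows "\<bar>supp d K v\<bar> \<le> B * (\<Sum>i<d. \<bar>v i\<bar>)"
proof -
  obtain x where x: "x \<in> K" using assms by auto
  have b: "bounded_Rd d K" unfolding bounded_Rd_def using assms(2) by blast
  have "\<bar>dot d v x\<bar> \<le> B * (\<Sum>i<d. \<bar>v i\<bar>)"
    by (rule abs_dot_le) (rule assms(2)[OF x])
  then have "- (B * (\<Sum>i<d. \<bar>v i\<bar>)) \<le> dot d v x"
    by simp
  also have "\<dots> \<le> supp d K v" by (rule dot_le_supp[OF b x])
  finally have "- (B * (\<Sum>i<d. \<bar>v i\<bar>)) \<le> supp d K v" .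
  moreover have "supp d K v \<le> B * (\<Sum>i<d. \<bar>v i\<bar>)"
    using assms by (intro supp_least) (auto intro: order.trans[OF abs_ge_self abs_dot_le])
  ultimately show ?thesis by linarith
qed

text \<open>Subadditivity makes the support function Lipschitz with respect to the sum of the first
  \<open>d\<close> absolute coordinates, and each coordinate is continuous.\<close>

lemma continuous_on_supp:
  assumes "bounded_Rd d K" "K \<noteq> {}"
  shows "continuous_on UNIV (supp d K)"
proof -
  obtain B where B: "\<And>x i. x \<in> K \<Longrightarrow> i < d \<Longrightarrow> \<bar>x i\<bar> \<le> B"
    using assms by (auto simp: bounded_Rd_def)
  have lip: "supp d K v \<le> supp d K w + B * (\<Sum>i<d. \<bar>v i - w i\<bar>)" for v w
  proof -
    have "supp d K v = supp d K (\<lambda>i. w i + (v i - w i))" by simp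
    also have "\<dots> \<le> supp d K w + supp d K (\<lambda>i. v i - w i)"
      by (rule supp_add_le[OF assms])
    also have "supp d K (\<lambda>i. v i - w i) \<le> B * (\<Sum>i<d. \<bar>v i - w i\<bar>)"
      using supp_le_bound[of K d B "\<lambda>i. v i - w i"] assms(2) B by auto
    finally show ?thesis by simp
  qed
  show ?thesis
    unfolding continuous_on_def
  proof
    fix w :: "nat \<Rightarrow> real"
    have coord: "((\<lambda>v. v i) \<longlongrightarrow> w i) (at w)" for i
      using continuous_on_product_coordinates[of i] unfolding continuous_on_def by auto
    have z: "((\<lambda>v. B * (\<Sum>i<d. \<bar>v i - w i\<bar>)) \<longlongrightarrow> B * (\<Sum>i<d. \<bar>w i - w i\<bar>)) (at w)"
      by (intro tendsto_intros coord)
    have "(supp d K \<longlongrightarrow> supp d K w) (at w)"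
    proof (rule tendsto_sandwich[OF always_eventually always_eventually])
      show "\<forall>v. supp d K w - B * (\<Sum>i<d. \<bar>v i - w i\<bar>) \<le> supp d K v"
        using lip[of w] by (simp add: abs_minus_commute algebra_simps)
      show "\<forall>v. supp d K v \<le> supp d K w + B * (\<Sum>i<d. \<bar>v i - w i\<bar>)"
        using lip by simp
      show "((\<lambda>v. supp d K w - B * (\<Sum>i<d. \<bar>v i - w i\<bar>)) \<longlongrightarrow> supp d K w) (at w)"
        using tendsto_diff[OF tendsto_const z, of "supp d K w"] by simp
      show "((\<lambda>v. supp d K w + B * (\<Sum>i<d. \<bar>v i - w i\<bar>)) \<longlongrightarrow> supp d K w) (at w)"
        using tendsto_add[OF tendsto_const z, of "supp d K w"] by simp
    qed
    then show "(supp d K \<longlongrightarrow> supp d K w) (at w within UNIV)" by simp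
  qed
qed

text \<open>A point outside \<open>K\<close> would be separated from it by some \<open>w\<close>
  violating the last hypothesis. Membership of the Steiner point and the bidual norm bound both go
  through this test.\<close>

lemma mem_of_dot_le_supp:
  assumes "closed K" "K \<subseteq> Rd d" "convex_in_Rd K" "K \<noteq> {}" "z \<in> Rd d"
    and "\<And>w. dot d w z \<le> supp d K w"
  shows "z \<in> K"
proof (rule ccontr)
  assume "z \<notin> K"
  then obtain w b where "\<And>x. x \<in> K \<Longrightarrow> dot d w x \<le> b" "b < dot d w z"
    using separation_Rd[OF assms(1-5)] by metis
  then have "supp d K w < dot d w z"
    using supp_least[OF assms(4)] by (meson le_less_trans)
  then show False using assms(6)[of w] by linarith
qed

section \<open>Lebesgue measure\<close>

text \<open>Points of this measure space take the value \<open>undefined\<close>, not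
  \<open>0\<close>, from index \<open>d\<close> on, so they need not lie in \<open>Rd d\<close>.
  This is why the transformation lemmas assume in \<open>dep\<close> that a function reads only the
  first \<open>d\<close> coordinates.\<close>

definition leb_Rd :: "nat \<Rightarrow> (nat \<Rightarrow> real) measure" where
  "leb_Rd d = PiM {..<d} (\<lambda>_. lborel)"

lemma product_sigma_finite_lborel: "product_sigma_finite (\<lambda>_::nat. lborel :: real measure)"
  by (simp add: product_sigma_finite_def sigma_finite_lborel)

lemma emeasure_leb_Rd_PiE:
  assumes "\<And>i. i < d \<Longrightarrow> A i \<in> sets borel"
  shows "emeasure (leb_Rd d) (PiE {..<d} A) = (\<Prod>i<d. emeasure lborel (A i))"
  unfolding leb_Rd_def using assms
  by (intro product_sigma_finite.emeasure_PiM[OF product_sigma_finite_lborel]) auto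

text \<open>The inclusion into the full function space is measurable coordinate by coordinate; the
  coordinates from \<open>d\<close> on are constant there.\<close>

lemma continuous_imp_measurable_leb_Rd:
  fixes f :: "(nat \<Rightarrow> real) \<Rightarrow> real"
  assumes "continuous_on UNIV f"
  shows "f \<in> borel_measurable (leb_Rd d)"
proof -
  have "(\<lambda>v. v) \<in> measurable (leb_Rd d) (borel :: (nat \<Rightarrow> real) measure)"
  proof (rule measurable_coordinatewise_then_product)
    fix i :: nat
    show "(\<lambda>v. v i) \<in> borel_measurable (leb_Rd d)"
    proof (cases "i < d")
      case True
      then have "(\<lambda>v. v i) \<in> measurable (leb_Rd d) lborel"
        unfolding leb_Rd_def by (intro measurable_component_singleton) auto
      then show ?thesis by simp
    next
      case False
      then have "v i = undefined" if "v \<in> space (leb_Rd d)" for v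
        using that by (auto simp: leb_Rd_def space_PiM PiE_def extensional_def)
      then show ?thesis
        by (subst measurable_cong[where g = "\<lambda>_. undefined"]) auto
    qed
  qed
  from measurable_compose[OF this borel_measurable_continuous_onI[OF assms]]
  show ?thesis .
qed

lemma measurable_affine_leb_Rd:
  "(\<lambda>v. \<lambda>i\<in>{..<d}. t i + c * v i) \<in> measurable (leb_Rd d) (leb_Rd d)"
  unfolding leb_Rd_def
proof (rule measurable_restrict)
  fix i assume "i \<in> {..<d}"
  then have "(\<lambda>v. v i) \<in> measurable (PiM {..<d} (\<lambda>_. lborel)) (lborel :: real measure)"
    by (intro measurable_component_singleton) auto
  then show "(\<lambda>v. t i + c * v i) \<in> measurable (PiM {..<d} (\<lambda>_. lborel)) (lborel :: real measure)"
    by simp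
qed

text \<open>A product measure is determined by its values on boxes, and there each of the
  \<open>d\<close> sides contributes one factor \<open>c\<close>. Translations are the case
  \<open>c = 1\<close>, dilations the case \<open>t = 0\<close>.\<close>

lemma leb_Rd_affine:
  assumes "c > 0"
  shows "leb_Rd d =
    scale_measure (ennreal (c ^ d)) (distr (leb_Rd d) (leb_Rd d) (\<lambda>v. \<lambda>i\<in>{..<d}. t i + c * v i))"
    (is "_ = ?P")
proof -
  let ?T = "\<lambda>v. \<lambda>i\<in>{..<d}. t i + c * v i"
  have "?P = PiM {..<d} (\<lambda>_. lborel)"
  proof (rule product_sigma_finite.PiM_eqI[OF product_sigma_finite_lborel])
    show "finite {..<d}" by simp
    show "sets ?P = sets (PiM {..<d} (\<lambda>_. lborel))"
      by (simp add: leb_Rd_def)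
    fix A :: "nat \<Rightarrow> real set"
    assume "\<And>i. i \<in> {..<d} \<Longrightarrow> A i \<in> sets lborel"
    then have A: "\<And>i. i < d \<Longrightarrow> A i \<in> sets borel" by simp
    have pre: "?T -` PiE {..<d} A \<inter> space (leb_Rd d) = PiE {..<d} (\<lambda>i. (\<lambda>x. t i + c * x) -` A i)"
      by (auto simp: leb_Rd_def space_PiM PiE_def Pi_def)
    have PA: "PiE {..<d} A \<in> sets (leb_Rd d)"
      unfolding leb_Rd_def using A by (intro sets_PiM_I_finite) auto
    have one: "emeasure lborel (A i) = ennreal c * emeasure lborel ((\<lambda>x. t i + c * x) -` A i)"
      if "i < d" for i
    proof -
      have [measurable]: "A i \<in> sets borel" using A that by simp
      have "emeasure lborel (A i)
          = emeasure (density (distr lborel borel (\<lambda>x. t i + c * x)) (\<lambda>_. ennreal \<bar>c\<bar>)) (A i)"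
        using lborel_real_affine[of c "t i"] assms by simp
      also have "\<dots> = ennreal c * emeasure lborel ((\<lambda>x. t i + c * x) -` A i)"
        using assms by (simp add: emeasure_density_const emeasure_distr)
      finally show ?thesis .
    qed
    have vm: "(\<lambda>x. t i + c * x) -` A i \<in> sets borel" if "i < d" for i
    proof -
      have "(\<lambda>x. t i + c * x) \<in> borel_measurable (borel :: real measure)" by simp
      from measurable_sets[OF this A[OF that]] show ?thesis by simp
    qed
    have "emeasure ?P (PiE {..<d} A)
        = ennreal (c ^ d) * emeasure (leb_Rd d) (PiE {..<d} (\<lambda>i. (\<lambda>x. t i + c * x) -` A i))"
      by (simp add: emeasure_distr[OF measurable_affine_leb_Rd PA] pre)
    also have "\<dots> = ennreal c ^ d * (\<Prod>i<d. emeasure lborel ((\<lambda>x. t i + c * x) -` A i))"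
      using assms vm by (simp add: emeasure_leb_Rd_PiE ennreal_power)
    also have "\<dots> = (\<Prod>i<d. emeasure lborel (A i))"
      using one by (simp add: prod.distrib)
    finally show "emeasure ?P (PiE {..<d} A) = (\<Prod>i\<in>{..<d}. emeasure lborel (A i))" .
  qed
  then show ?thesis by (simp add: leb_Rd_def)
qed

lemma leb_Rd_translate:
  "distr (leb_Rd d) (leb_Rd d) (\<lambda>v. \<lambda>i\<in>{..<d}. v i + w i) = leb_Rd d"
  using leb_Rd_affine[of 1 d w, symmetric]
  by (simp add: add.commute)

text \<open>The measure-preserving map has to restrict to \<open>{..<d}\<close> to stay in the
  space; by \<open>dep\<close> the integrand does not notice the restriction.\<close>

lemma integral_leb_Rd_translate:
  fixes f :: "(nat \<Rightarrow> real) \<Rightarrow> real"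
  assumes [measurable]: "f \<in> borel_measurable (leb_Rd d)"
    and dep: "\<And>u v. (\<And>i. i < d \<Longrightarrow> u i = v i) \<Longrightarrow> f u = f v"
  shows "(\<integral>v. f (\<lambda>i. v i + w i) \<partial>leb_Rd d) = (\<integral>v. f v \<partial>leb_Rd d)"
proof -
  have T: "(\<lambda>v. \<lambda>i\<in>{..<d}. v i + w i) \<in> measurable (leb_Rd d) (leb_Rd d)"
    using measurable_affine_leb_Rd[of w 1 d] by (simp add: add.commute)
  have "(\<integral>v. f v \<partial>leb_Rd d) = (\<integral>v. f v \<partial>distr (leb_Rd d) (leb_Rd d) (\<lambda>v. \<lambda>i\<in>{..<d}. v i + w i))"
    by (simp add: leb_Rd_translate)
  also have "\<dots> = (\<integral>v. f (\<lambda>i\<in>{..<d}. v i + w i) \<partial>leb_Rd d)"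
    by (rule integral_distr[OF T assms(1)])
  also have "\<dots> = (\<integral>v. f (\<lambda>i. v i + w i) \<partial>leb_Rd d)"
    by (intro Bochner_Integration.integral_cong refl dep) auto
  finally show ?thesis by simp
qed

text \<open>The dilation by \<open>c\<close> pulls the larger sublevel set back to the smaller one.
  Applied to \<open>dnorm\<close> this is the scaling law for volumes of dual balls.\<close>

lemma emeasure_leb_Rd_dilate:
  assumes "c > 0" and [measurable]: "f \<in> borel_measurable (leb_Rd d)"
    and dep: "\<And>u v. (\<And>i. i < d \<Longrightarrow> u i = v i) \<Longrightarrow> f u = f v"
    and hom: "\<And>v. f (\<lambda>i. c * v i) = c * f v"
  shows "emeasure (leb_Rd d) {v \<in> space (leb_Rd d). f v \<le> c * r}
       = ennreal (c ^ d) * emeasure (leb_Rd d) {v \<in> space (leb_Rd d). f v \<le> r}"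
proof -
  let ?M = "leb_Rd d"
  let ?T = "\<lambda>v. \<lambda>i\<in>{..<d}. 0 + c * v i"
  have S: "{v \<in> space ?M. f v \<le> c * r} \<in> sets ?M" by measurable
  have "f (?T v) = c * f v" for v
    using dep[of "?T v" "\<lambda>i. c * v i"] hom by simp
  then have "?T -` {v \<in> space ?M. f v \<le> c * r} \<inter> space ?M = {v \<in> space ?M. f v \<le> r}"
    using assms(1) measurable_space[OF measurable_affine_leb_Rd[of "\<lambda>_. 0" c d]] by auto
  then have "emeasure (distr ?M ?M ?T) {v \<in> space ?M. f v \<le> c * r} = emeasure ?M {v \<in> space ?M. f v \<le> r}"
    by (simp only: emeasure_distr[OF measurable_affine_leb_Rd S])
  then show ?thesis
    by (subst leb_Rd_affine[OF assms(1), of d "\<lambda>_. 0"]) simp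
qed

section \<open>Gradients of convex functions\<close>

lemma dot_commute: "dot d v x = dot d x v"
  by (simp add: dot_def mult.commute)

text \<open>Linearity is used to build \<open>w\<close> up one coordinate at a time, by induction on
  the number of coordinates already included.\<close>

lemma additive_eq_dot:
  fixes p :: "(nat \<Rightarrow> real) \<Rightarrow> real"
  assumes dep: "\<And>u v. (\<And>i. i < d \<Longrightarrow> u i = v i) \<Longrightarrow> p u = p v"
    and add: "\<And>u v. p (\<lambda>i. u i + v i) = p u + p v"
    and scale: "\<And>c v. p (\<lambda>i. c * v i) = c * p v"
  shows "p w = dot d w (\<lambda>j. if j < d then p (\<lambda>i. if i = j then 1 else 0) else 0)"
proof -
  have "p (\<lambda>i. if i < n then w i else 0) = (\<Sum>j<n. w j * p (\<lambda>i. if i = j then 1 else 0))" for n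
  proof (induction n)
    case 0
    show ?case using scale[of 0 "\<lambda>_. 0"] by simp
  next
    case (Suc n)
    have "(\<lambda>i. if i < Suc n then w i else 0)
        = (\<lambda>i. (if i < n then w i else 0) + w n * (if i = n then 1 else 0))"
      by (auto simp: less_Suc_eq)
    then show ?case by (simp only: add scale Suc) simp
  qed
  from this[of d] dep[of w "\<lambda>i. if i < d then w i else 0"]
  show ?thesis by (simp add: dot_def)
qed

text \<open>Difference quotients of a convex function are monotone, so one-sided directional
  derivatives exist, and they are sublinear in the direction. The vanishing symmetric second
  difference makes them odd, and an odd sublinear function is linear.\<close>

lemma gradient_exists:
  fixes \<phi> :: "(nat \<Rightarrow> real) \<Rightarrow> real"
  assumes dep: "\<And>u v. (\<And>i. i < d \<Longrightarrow> u i = v i) \<Longrightarrow> \<phi> u = \<phi> v"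
    and conv: "\<And>u v t. 0 \<le> t \<Longrightarrow> t \<le> 1 \<Longrightarrow>
        \<phi> (\<lambda>i. (1 - t) * u i + t * v i) \<le> (1 - t) * \<phi> u + t * \<phi> v"
    and smooth: "\<And>w. ((\<lambda>e. (\<phi> (\<lambda>i. e * w i) + \<phi> (\<lambda>i. - e * w i) - 2 * \<phi> (\<lambda>i. 0)) / e)
        \<longlongrightarrow> 0) (at_right 0)"
  obtains s where "s \<in> Rd d"
    "\<And>w. ((\<lambda>e. (\<phi> (\<lambda>i. e * w i) - \<phi> (\<lambda>i. 0)) / e) \<longlongrightarrow> dot d w s) (at_right 0)"
proof -
  define q where "q w e = (\<phi> (\<lambda>i. e * w i) - \<phi> (\<lambda>i. 0)) / e" for w e
  have mono: "q w a \<le> q w b" if "0 < a" "a \<le> b" for w a b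
  proof -
    have "\<phi> (\<lambda>i. (1 - a / b) * 0 + a / b * (b * w i)) \<le> (1 - a / b) * \<phi> (\<lambda>i. 0) + a / b * \<phi> (\<lambda>i. b * w i)"
      using conv[of "a / b" "\<lambda>i. 0" "\<lambda>i. b * w i"] that by auto
    then have "\<phi> (\<lambda>i. a * w i) - \<phi> (\<lambda>i. 0) \<le> a / b * (\<phi> (\<lambda>i. b * w i) - \<phi> (\<lambda>i. 0))"
      using that by (simp add: algebra_simps)
    then show ?thesis
      using that by (simp add: q_def field_simps)
  qed
  have pm: "0 \<le> q w a + q (\<lambda>i. - w i) a" if "0 < a" for w a
  proof -
    have "\<phi> (\<lambda>i. (1 - 1/2) * (a * w i) + 1/2 * (a * - w i))
        \<le> (1 - 1/2) * \<phi> (\<lambda>i. a * w i) + 1/2 * \<phi> (\<lambda>i. a * - w i)"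
      by (rule conv[of "1/2" "\<lambda>i. a * w i" "\<lambda>i. a * - w i"]) auto
    then have "0 \<le> (\<phi> (\<lambda>i. a * w i) - \<phi> (\<lambda>i. 0)) + (\<phi> (\<lambda>i. a * - w i) - \<phi> (\<lambda>i. 0))"
      by simp
    then show ?thesis
      using that by (simp add: q_def flip: add_divide_distrib)
  qed
  \<comment> \<open>The quotients need a lower bound for their infimum to be the limit. For
    \<open>a \<le> 1\<close> the quotient in the opposite direction is at most its value at
    \<open>1\<close>; for larger \<open>a\<close> the comparison passes through
    \<open>a = 1\<close>.\<close>
  have low: "- q (\<lambda>i. - w i) 1 \<le> q w a" if "0 < a" for w a
    using mono[of a 1 "\<lambda>i. - w i"] mono[of 1 a w] pm[of a w] pm[of 1 w] that by linarith
  define p where "p w = Inf (q w ` {0<..})" for w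
  have lim: "(q w \<longlongrightarrow> p w) (at_right 0)" for w
    using Lim_right_bound[of UNIV 0 "q w" "- q (\<lambda>i. - w i) 1"] mono low
    by (simp add: p_def)
  have ev: "eventually (\<lambda>e::real. 0 < e) (at_right 0)"
    by (simp add: eventually_at_filter)
  have pos_scale: "p (\<lambda>i. c * w i) = c * p w" if c: "c > 0" for c w
  proof -
    have "filterlim (\<lambda>e. c * e) (at_right 0) (at_right 0)"
      using c by (intro filterlim_times_pos[of "\<lambda>e. e" 0]) (auto intro: filterlim_ident)
    then have "((\<lambda>e. q w (c * e)) \<longlongrightarrow> p w) (at_right 0)"
      by (rule filterlim_compose[OF lim])
    then have "((\<lambda>e. c * q w (c * e)) \<longlongrightarrow> c * p w) (at_right 0)"
      by (intro tendsto_intros)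
    moreover have "c * q w (c * e) = q (\<lambda>i. c * w i) e" for e
      using c by (simp add: q_def ac_simps)
    ultimately show ?thesis
      using tendsto_unique[OF _ lim] by simp
  qed
  \<comment> \<open>The quotients in the directions \<open>w\<close> and \<open>- w\<close> add up
    to the expression that \<open>smooth\<close> sends to \<open>0\<close>.\<close>
  have neg: "p (\<lambda>i. - w i) = - p w" for w
  proof -
    have "((\<lambda>e. q w e + q (\<lambda>i. - w i) e) \<longlongrightarrow> p w + p (\<lambda>i. - w i)) (at_right 0)"
      by (intro tendsto_intros lim)
    moreover have "((\<lambda>e. q w e + q (\<lambda>i. - w i) e) \<longlongrightarrow> 0) (at_right 0)"
      using smooth[of w] by (simp add: q_def algebra_simps flip: add_divide_distrib diff_divide_distrib)
    ultimately show ?thesis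
      using tendsto_unique[of "at_right (0::real)"] by fastforce
  qed
  have p0: "p (\<lambda>i. 0) = 0"
    using neg[of "\<lambda>i. 0"] by simp
  have scale: "p (\<lambda>i. c * w i) = c * p w" for c w
  proof (cases c "0::real" rule: linorder_cases)
    case less
    have "p (\<lambda>i. c * w i) = - p (\<lambda>i. (- c) * w i)"
      using neg[of "\<lambda>i. (- c) * w i"] by simp
    then show ?thesis using pos_scale[of "- c" w] less by simp
  qed (use p0 pos_scale in auto)
  \<comment> \<open>Midpoint convexity yields the inequality for half the sum; homogeneity removes
    the factor one half.\<close>
  have sub: "p (\<lambda>i. u i + v i) \<le> p u + p v" for u v
  proof -
    have le: "q (\<lambda>i. (u i + v i) / 2) e \<le> (q u e + q v e) / 2" if "0 < e" for e
    proof -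
      have "\<phi> (\<lambda>i. (1 - 1/2) * (e * u i) + 1/2 * (e * v i))
          \<le> (1 - 1/2) * \<phi> (\<lambda>i. e * u i) + 1/2 * \<phi> (\<lambda>i. e * v i)"
        by (rule conv[of "1/2" "\<lambda>i. e * u i" "\<lambda>i. e * v i"]) auto
      moreover have "(\<lambda>i. (1 - 1/2) * (e * u i) + 1/2 * (e * v i)) = (\<lambda>i. e * ((u i + v i) / 2))"
        by (auto simp: algebra_simps)
      ultimately have "\<phi> (\<lambda>i. e * ((u i + v i) / 2)) - \<phi> (\<lambda>i. 0)
          \<le> ((\<phi> (\<lambda>i. e * u i) - \<phi> (\<lambda>i. 0)) + (\<phi> (\<lambda>i. e * v i) - \<phi> (\<lambda>i. 0))) / 2"
        by simp
      note avg = divide_right_mono[OF this less_imp_le[OF that]]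
      have "(X + Y) / 2 / e = (X / e + Y / e) / 2" for X Y
        by (simp add: add_divide_distrib)
      with avg show ?thesis unfolding q_def by (simp only:)
    qed
    have lim2: "((\<lambda>e. (q u e + q v e) / 2) \<longlongrightarrow> (p u + p v) / 2) (at_right 0)"
      by (intro tendsto_intros lim) auto
    have "p (\<lambda>i. (u i + v i) / 2) \<le> (p u + p v) / 2"
      by (rule tendsto_le[OF _ lim2 lim]) (use ev le in \<open>auto elim: eventually_mono\<close>)
    moreover have "p (\<lambda>i. (u i + v i) / 2) = p (\<lambda>i. u i + v i) / 2"
      using scale[of "1/2" "\<lambda>i. u i + v i"] by simp
    ultimately show ?thesis by simp
  qed
  \<comment> \<open>Subadditivity for \<open>- u\<close> and \<open>- v\<close> together with
    oddness gives the reverse inequality.\<close>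
  have add: "p (\<lambda>i. u i + v i) = p u + p v" for u v
  proof -
    have "p (\<lambda>i. - u i + - v i) = - p (\<lambda>i. u i + v i)"
      using neg[of "\<lambda>i. u i + v i"] by (simp add: algebra_simps)
    then show ?thesis
      using sub[of u v] sub[of "\<lambda>i. - u i" "\<lambda>i. - v i"] neg[of u] neg[of v] by simp
  qed
  have dep_p: "p u = p v" if "\<And>i. i < d \<Longrightarrow> u i = v i" for u v
  proof -
    have "\<phi> (\<lambda>i. e * u i) = \<phi> (\<lambda>i. e * v i)" for e
      by (rule dep) (simp add: that)
    then have "q u = q v" by (auto simp: q_def)
    then show ?thesis by (simp add: p_def)
  qed
  define s where "s = (\<lambda>j. if j < d then p (\<lambda>i. if i = j then 1 else 0) else 0)"
  have p_eq: "p w = dot d w s" for w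
    unfolding s_def
  proof (rule additive_eq_dot)
    show "p u = p v" if "\<And>i. i < d \<Longrightarrow> u i = v i" for u v
      using that by (rule dep_p)
  qed (rule add scale)+
  show thesis
  proof
    show "s \<in> Rd d" by (simp add: s_def topspace_Euclidean_space)
    show "((\<lambda>e. (\<phi> (\<lambda>i. e * w i) - \<phi> (\<lambda>i. 0)) / e) \<longlongrightarrow> dot d w s) (at_right 0)" for w
      using lim[of w] by (simp add: q_def[abs_def] p_eq)
  qed
qed

section \<open>The norm and its dual\<close>

lemma closed_Rd: "closed (Rd d)"
  using closedin_Euclidean_space_iff closedin_topspace by blast

lemma Rd_lin:
  assumes "x \<in> Rd d" "y \<in> Rd d"
  shows "(\<lambda>i. x i + y i) \<in> Rd d" "(\<lambda>i. x i - y i) \<in> Rd d" "(\<lambda>i. c * x i) \<in> Rd d"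
  using assms by (auto simp: topspace_Euclidean_space)

lemma unit_in_Rd: "j < d \<Longrightarrow> (\<lambda>i. if i = j then c else 0) \<in> Rd d"
  by (auto simp: topspace_Euclidean_space)

locale normed_Rd =
  fixes d :: nat and N :: "(nat \<Rightarrow> real) \<Rightarrow> real"
  assumes d_ge: "1 \<le> d" and norm: "norm_on_Rd d N"
begin

lemma N_nonneg: "x \<in> Rd d \<Longrightarrow> 0 \<le> N x"
  and N_eq_0: "x \<in> Rd d \<Longrightarrow> N x = 0 \<longleftrightarrow> x = (\<lambda>i. 0)"
  and N_scale: "x \<in> Rd d \<Longrightarrow> N (\<lambda>i. c * x i) = \<bar>c\<bar> * N x"
  and N_triangle: "x \<in> Rd d \<Longrightarrow> y \<in> Rd d \<Longrightarrow> N (\<lambda>i. x i + y i) \<le> N x + N y"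
  using norm by (auto simp: norm_on_Rd_def)

lemma N_minus: "x \<in> Rd d \<Longrightarrow> N (\<lambda>i. - x i) = N x"
  using N_scale[of x "-1"] by simp

lemma N_diff_commute:
  assumes "x \<in> Rd d" "y \<in> Rd d"
  shows "N (\<lambda>i. x i - y i) = N (\<lambda>i. y i - x i)"
  using N_minus[OF Rd_lin(2)[OF assms]] by simp

lemma N_diff_triangle:
  assumes "x \<in> Rd d" "y \<in> Rd d" "z \<in> Rd d"
  shows "N (\<lambda>i. x i - z i) \<le> N (\<lambda>i. x i - y i) + N (\<lambda>i. y i - z i)"
  using N_triangle[OF Rd_lin(2)[OF assms(1,2)] Rd_lin(2)[OF assms(2,3)]] by simp

definition unit :: "nat \<Rightarrow> nat \<Rightarrow> real" where
  "unit j = (\<lambda>i. if i = j then 1 else 0)"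

lemma unit_Rd: "j < d \<Longrightarrow> unit j \<in> Rd d"
  by (simp add: unit_def unit_in_Rd)

lemma N_unit_pos:
  assumes "j < d"
  shows "0 < N (unit j)"
proof -
  have "unit j j \<noteq> 0" by (simp add: unit_def)
  then have "unit j \<noteq> (\<lambda>i. 0)" by metis
  then show ?thesis
    using N_nonneg[OF unit_Rd[OF assms]] N_eq_0[OF unit_Rd[OF assms]] by linarith
qed

lemma N_le_sum:
  assumes "x \<in> Rd d"
  shows "N x \<le> (\<Sum>j<d. \<bar>x j\<bar> * N (unit j))"
proof -
  have "N (\<lambda>i. if i < n then x i else 0) \<le> (\<Sum>j<n. \<bar>x j\<bar> * N (unit j))" if "n \<le> d" for n
    using that
  proof (induction n)
    case 0
    have "(\<lambda>i. 0) \<in> Rd d" by (simp add: topspace_Euclidean_space)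
    from N_eq_0[OF this] show ?case by simp
  next
    case (Suc n)
    have eq: "(\<lambda>i. if i < Suc n then x i else 0) = (\<lambda>i. (if i < n then x i else 0) + x n * unit n i)"
      by (auto simp: less_Suc_eq unit_def)
    have "(\<lambda>i. if i < n then x i else 0) \<in> Rd d" "(\<lambda>i. x n * unit n i) \<in> Rd d"
      using Suc.prems by (auto simp: topspace_Euclidean_space unit_def)
    from N_triangle[OF this] Suc show ?case
      by (simp add: eq N_scale unit_Rd)
  qed
  moreover have "(\<lambda>i. if i < d then x i else 0) = x"
    using assms by (auto simp: topspace_Euclidean_space)
  ultimately show ?thesis by fastforce
qed

lemma continuous_on_N: "continuous_on (Rd d) N"
  unfolding continuous_on_def
proof
  fix y assume y: "y \<in> Rd d"
  let ?F = "at y within Rd d"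
  let ?g = "\<lambda>x. \<Sum>j<d. \<bar>x j - y j\<bar> * N (unit j)"
  have coord: "((\<lambda>v. v i) \<longlongrightarrow> y i) ?F" for i
    using continuous_on_subset[OF continuous_on_product_coordinates[of i], of "Rd d"] y
    unfolding continuous_on_def by auto
  have "(?g \<longlongrightarrow> (\<Sum>j<d. \<bar>y j - y j\<bar> * N (unit j))) ?F"
    by (intro tendsto_intros coord)
  then have z: "(?g \<longlongrightarrow> 0) ?F" by simp
  have le: "\<bar>N x - N y\<bar> \<le> ?g x" if x: "x \<in> Rd d" for x
  proof -
    have xy: "(\<lambda>i. x i - y i) \<in> Rd d" "(\<lambda>i. y i - x i) \<in> Rd d" using x y Rd_lin by auto
    have "N x \<le> N (\<lambda>i. x i - y i) + N y"
      using N_triangle[OF xy(1) y] by simp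
    moreover have "N y \<le> N (\<lambda>i. y i - x i) + N x"
      using N_triangle[OF xy(2) x] by simp
    ultimately show ?thesis
      using N_le_sum[OF xy(1)] N_diff_commute[OF x y] by linarith
  qed
  have "((\<lambda>x. N x - N y) \<longlongrightarrow> 0) ?F"
    by (rule Lim_null_comparison[OF _ z]) (auto simp: eventually_at_filter le)
  then show "(N \<longlongrightarrow> N y) ?F" by (rule LIM_zero_cancel)
qed

text \<open>One half of the equivalence of norms: \<open>N\<close> has a positive minimum on the
  unit sphere of the coordinate sum norm, which is compact, and homogeneity extends the bound to all
  vectors.\<close>

lemma coord_le_N: "\<exists>c>0. \<forall>x\<in>Rd d. \<forall>i<d. \<bar>x i\<bar> \<le> c * N x"
proof -
  define S where "S = Rd d \<inter> {x. (\<Sum>i<d. \<bar>x i\<bar>) = 1}"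
  have cont: "continuous_on A (\<lambda>x. \<Sum>i<d. \<bar>x i\<bar> :: real)" for A
    by (intro continuous_intros continuous_on_subset[OF continuous_on_product_coordinates]) auto
  have "closed S"
    unfolding S_def by (intro closed_Int closed_Rd closed_Collect_eq cont continuous_intros)
  moreover have "\<bar>x i\<bar> \<le> 1" if "x \<in> S" "i < d" for x i
    using that member_le_sum[of i "{..<d}" "\<lambda>i. \<bar>x i\<bar>"] by (auto simp: S_def)
  ultimately have "compact S"
    by (intro compact_bounded_Rd[of S d 1]) (auto simp: S_def)
  moreover have "unit 0 \<in> S"
    using d_ge unit_Rd[of 0] by (simp add: S_def unit_def if_distrib cong: if_cong)
  ultimately obtain y where y: "y \<in> S" "\<And>x. x \<in> S \<Longrightarrow> N y \<le> N x"
    using continuous_attains_inf[of S N] continuous_on_subset[OF continuous_on_N, of S]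
    by (auto simp: S_def)
  have "y \<in> Rd d" "y \<noteq> (\<lambda>i. 0)" using y by (auto simp: S_def)
  then have m: "0 < N y" using N_nonneg[of y] N_eq_0[of y] by linarith
  have "\<bar>x i\<bar> \<le> (1 / N y) * N x" if x: "x \<in> Rd d" and i: "i < d" for x i
  proof (cases "x i = 0")
    case True
    then show ?thesis using N_nonneg[OF x] m by simp
  next
    case False
    let ?t = "\<Sum>i<d. \<bar>x i\<bar>"
    have t: "\<bar>x i\<bar> \<le> ?t" using i by (intro member_le_sum) auto
    then have tp: "0 < ?t" using False by linarith
    have "(\<lambda>i. (1 / ?t) * x i) \<in> S"
      using tp Rd_lin(3)[OF x x, of "1 / ?t"] by (simp add: S_def abs_mult flip: sum_divide_distrib)
    from y(2)[OF this] have "N y \<le> N x / ?t"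
      using tp N_scale[OF x, of "1 / ?t"] by simp
    then have "?t \<le> N x / N y" using tp m by (simp add: field_simps)
    then show ?thesis using t by simp
  qed
  then show ?thesis using m by (intro exI[of _ "1 / N y"]) auto
qed

section \<open>Norm balls\<close>

definition nball :: "(nat \<Rightarrow> real) \<Rightarrow> real \<Rightarrow> (nat \<Rightarrow> real) set" where
  "nball x0 r = {x \<in> Rd d. N (\<lambda>i. x i - x0 i) \<le> r}"

lemma nball_Rd: "nball x0 r \<subseteq> Rd d"
  by (auto simp: nball_def)

lemma closed_nball:
  assumes "x0 \<in> Rd d"
  shows "closed (nball x0 r)"
proof -
  have "continuous_on (Rd d) (\<lambda>x. N (\<lambda>i. x i - x0 i))"
  proof (rule continuous_on_compose2[OF continuous_on_N])
    show "continuous_on (Rd d) (\<lambda>x i. x i - x0 i)"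
      by (intro continuous_intros continuous_on_subset[OF continuous_on_product_coordinates]) auto
  qed (use assms Rd_lin in auto)
  from continuous_closed_preimage[OF this closed_Rd closed_atMost[of r]]
  show ?thesis by (simp add: nball_def vimage_def Int_def)
qed

lemma convex_nball:
  assumes x0: "x0 \<in> Rd d"
  shows "convex_in_Rd (nball x0 r)"
  unfolding convex_in_Rd_def
proof (intro ballI)
  fix x y u assume x: "x \<in> nball x0 r" and y: "y \<in> nball x0 r" and u: "u \<in> {0..1::real}"
  have xy: "x \<in> Rd d" "y \<in> Rd d" using x y by (auto simp: nball_def)
  let ?a = "\<lambda>i. x i - x0 i" and ?b = "\<lambda>i. y i - x0 i"
  have ab: "?a \<in> Rd d" "?b \<in> Rd d" using xy x0 Rd_lin by auto
  have "N (\<lambda>i. (1 - u) * ?a i + u * ?b i) \<le> (1 - u) * N ?a + u * N ?b"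
    using N_triangle[OF Rd_lin(3)[OF ab(1) ab(1), of "1 - u"] Rd_lin(3)[OF ab(2) ab(2), of u]] u
      N_scale[OF ab(1), of "1 - u"] N_scale[OF ab(2), of u] by simp
  also have "\<dots> \<le> (1 - u) * r + u * r"
    using x y u by (intro add_mono mult_left_mono) (auto simp: nball_def)
  finally have "N (\<lambda>i. ((1 - u) * x i + u * y i) - x0 i) \<le> r"
    by (simp add: algebra_simps)
  moreover have "(\<lambda>i. (1 - u) * x i + u * y i) \<in> Rd d"
    using xy by (auto simp: topspace_Euclidean_space)
  ultimately show "(\<lambda>i. (1 - u) * x i + u * y i) \<in> nball x0 r"
    by (simp add: nball_def)
qed

lemma bounded_nball:
  assumes x0: "x0 \<in> Rd d"
  shows "bounded_Rd d (nball x0 r)"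
proof -
  obtain c where c: "c > 0" "\<And>x i. x \<in> Rd d \<Longrightarrow> i < d \<Longrightarrow> \<bar>x i\<bar> \<le> c * N x"
    using coord_le_N by blast
  have "\<bar>x i\<bar> \<le> c * r + (\<Sum>i<d. \<bar>x0 i\<bar>)" if "x \<in> nball x0 r" "i < d" for x i
  proof -
    have x: "x \<in> Rd d" "N (\<lambda>i. x i - x0 i) \<le> r" using that by (auto simp: nball_def)
    have "\<bar>x i - x0 i\<bar> \<le> c * N (\<lambda>i. x i - x0 i)"
      using c(2)[OF Rd_lin(2)[OF x(1) x0] that(2)] .
    also have "\<dots> \<le> c * r" using c x by simp
    finally have "\<bar>x i - x0 i\<bar> \<le> c * r" .
    moreover have "\<bar>x0 i\<bar> \<le> (\<Sum>i<d. \<bar>x0 i\<bar>)" using that by (intro member_le_sum) auto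
    ultimately show ?thesis by linarith
  qed
  then show ?thesis by (auto simp: bounded_Rd_def)
qed

text \<open>The dual norm, written as the support function of the unit ball so that the lemmas on
  \<open>supp\<close> apply. It reads only the first \<open>d\<close> coordinates and can therefore
  be evaluated at points of \<open>leb_Rd d\<close>.\<close>

definition dnorm :: "(nat \<Rightarrow> real) \<Rightarrow> real" where
  "dnorm = supp d (nball (\<lambda>i. 0) 1)"

lemma zero_Rd: "(\<lambda>i. 0) \<in> Rd d"
  by (simp add: topspace_Euclidean_space)

lemma N_zero: "N (\<lambda>i. 0) = 0"
  using N_eq_0[OF zero_Rd] by simp

lemma zero_in_nball: "0 \<le> r \<Longrightarrow> (\<lambda>i. 0) \<in> nball (\<lambda>i. 0) r"
  by (simp add: nball_def zero_Rd N_zero)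

lemma dnorm_ball: "bounded_Rd d (nball (\<lambda>i. 0) 1)" "nball (\<lambda>i. 0) 1 \<noteq> {}"
  using bounded_nball[OF zero_Rd] zero_in_nball[of 1] by auto

lemma dnorm_add: "dnorm (\<lambda>i. v i + w i) \<le> dnorm v + dnorm w"
  unfolding dnorm_def by (rule supp_add_le[OF dnorm_ball])

lemma dnorm_scale: "0 \<le> c \<Longrightarrow> dnorm (\<lambda>i. c * v i) = c * dnorm v"
  unfolding dnorm_def by (rule supp_scale[OF dnorm_ball])

lemma dnorm_nonneg: "0 \<le> dnorm v"
  using dot_le_supp[OF dnorm_ball(1) zero_in_nball, of v] by (simp add: dnorm_def dot_def)

lemma dnorm_cong: "(\<And>i. i < d \<Longrightarrow> v i = w i) \<Longrightarrow> dnorm v = dnorm w"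
  unfolding dnorm_def by (rule supp_cong)

text \<open>The duality inequality, obtained by scaling a nonzero \<open>x\<close> to norm
  \<open>1\<close>.\<close>

lemma dot_le_dnorm:
  assumes "x \<in> Rd d"
  shows "dot d v x \<le> N x * dnorm v"
proof (cases "x = (\<lambda>i. 0)")
  case True
  then show ?thesis by (simp add: dot_def N_zero)
next
  case False
  then have p: "0 < N x" using N_nonneg[OF assms] N_eq_0[OF assms] by linarith
  have "(\<lambda>i. (1 / N x) * x i) \<in> nball (\<lambda>i. 0) 1"
    using p N_scale[OF assms, of "1 / N x"] Rd_lin(3)[OF assms assms, of "1 / N x"]
    by (simp add: nball_def)
  from dot_le_supp[OF dnorm_ball(1) this, of v] have "(1 / N x) * dot d v x \<le> dnorm v"
    by (simp only: dnorm_def dot_scale_right)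
  then show ?thesis using p by (simp add: field_simps)
qed

lemma dnorm_minus: "dnorm (\<lambda>i. - v i) = dnorm v"
proof -
  have "dnorm (\<lambda>i. - v i) \<le> dnorm v" for v
    unfolding dnorm_def
  proof (rule supp_least[OF dnorm_ball(2)])
    fix x assume x: "x \<in> nball (\<lambda>i. 0) 1"
    then have xr: "x \<in> Rd d" by (simp add: nball_def)
    have "(\<lambda>i. - x i) \<in> nball (\<lambda>i. 0) 1"
      using x N_minus[OF xr] by (simp add: nball_def topspace_Euclidean_space)
    from dot_le_supp[OF dnorm_ball(1) this, of v]
    show "dot d (\<lambda>i. - v i) x \<le> supp d (nball (\<lambda>i. 0) 1) v"
      by (simp add: dot_def)
  qed
  from this[of v] this[of "\<lambda>i. - v i"] show ?thesis by simp
qed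

text \<open>Pairing with basis vectors encloses dual balls in boxes, which gives them finite
  volume.\<close>

lemma abs_coord_le_dnorm:
  assumes "i < d"
  shows "\<bar>v i\<bar> \<le> N (unit i) * dnorm v"
proof -
  have e: "dot d v (unit i) = v i" for v
    using assms by (simp add: dot_def unit_def if_distrib cong: if_cong)
  show ?thesis
    using dot_le_dnorm[OF unit_Rd[OF assms], of v] dot_le_dnorm[OF unit_Rd[OF assms], of "\<lambda>i. - v i"]
    by (simp add: e dnorm_minus)
qed

text \<open>The opposite comparison: it puts a box inside the dual unit ball, which gives positive
  volume.\<close>

lemma dnorm_le_sum: "\<exists>c>0. \<forall>v. dnorm v \<le> c * (\<Sum>i<d. \<bar>v i\<bar>)"
proof -
  obtain B where B: "\<And>x i. x \<in> nball (\<lambda>i. 0) 1 \<Longrightarrow> i < d \<Longrightarrow> \<bar>x i\<bar> \<le> B"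
    using dnorm_ball(1) by (auto simp: bounded_Rd_def)
  have "dnorm v \<le> max B 1 * (\<Sum>i<d. \<bar>v i\<bar>)" for v
    using supp_le_bound[of "nball (\<lambda>i. 0) 1" d "max B 1" v] dnorm_ball(2) B
    by (fastforce simp: dnorm_def le_max_iff_disj)
  then show ?thesis by (intro exI[of _ "max B 1"]) auto
qed

text \<open>The norm is its own bidual: the ball of radius \<open>c\<close> has support function at
  least \<open>c * dnorm w\<close>, so separation forces \<open>z\<close> into it.\<close>

lemma N_le_of_dot_le_dnorm:
  assumes z: "z \<in> Rd d" and c: "0 \<le> c" and le: "\<And>w. dot d w z \<le> c * dnorm w"
  shows "N z \<le> c"
proof -
  have "z \<in> nball (\<lambda>i. 0) c"
  proof (rule mem_of_dot_le_supp[OF closed_nball[OF zero_Rd] nball_Rd convex_nball[OF zero_Rd] _ z])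
    show "nball (\<lambda>i. 0) c \<noteq> {}" using zero_in_nball[OF c] by auto
    fix w
    have b: "bounded_Rd d (nball (\<lambda>i. 0) c)" by (rule bounded_nball[OF zero_Rd])
    have "c * dnorm w \<le> supp d (nball (\<lambda>i. 0) c) w"
    proof (cases "c = 0")
      case True
      then show ?thesis
        using dot_le_supp[OF b zero_in_nball[OF c], of w] by (simp add: dot_def)
    next
      case False
      have "dnorm w \<le> supp d (nball (\<lambda>i. 0) c) w / c"
        unfolding dnorm_def
      proof (rule supp_least[OF dnorm_ball(2)])
        fix x assume "x \<in> nball (\<lambda>i. 0) 1"
        then have "(\<lambda>i. c * x i) \<in> nball (\<lambda>i. 0) c"
          using c False by (auto simp: nball_def N_scale Rd_lin mult_left_le)
        from dot_le_supp[OF b this, of w] show "dot d w x \<le> supp d (nball (\<lambda>i. 0) c) w / c"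
          using c False by (simp add: dot_scale_right field_simps)
      qed
      then show ?thesis using c False by (simp add: field_simps)
    qed
    with le show "dot d w z \<le> supp d (nball (\<lambda>i. 0) c) w" by (meson order.trans)
  qed
  then show ?thesis by (simp add: nball_def)
qed

end

section \<open>The dual cone density\<close>

context normed_Rd
begin

section \<open>Volumes of dual balls\<close>

abbreviation M :: "(nat \<Rightarrow> real) measure" where "M \<equiv> leb_Rd d"

abbreviation dball :: "real \<Rightarrow> (nat \<Rightarrow> real) set" where
  "dball r \<equiv> {v \<in> space M. dnorm v \<le> r}"

definition dvol :: "real \<Rightarrow> real" where "dvol r = measure M (dball r)"

lemma continuous_on_shift: "continuous_on UNIV (\<lambda>v::nat \<Rightarrow> real. \<lambda>i. v i + w i)"
  by (intro continuous_intros continuous_on_product_coordinates)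

lemma measurable_supp_shift:
  assumes "bounded_Rd d K" "K \<noteq> {}"
  shows "(\<lambda>v. supp d K (\<lambda>i. v i + w i)) \<in> borel_measurable M"
  by (intro continuous_imp_measurable_leb_Rd
      continuous_on_compose2[OF continuous_on_supp[OF assms] continuous_on_shift]) auto

lemma measurable_supp:
  "bounded_Rd d K \<Longrightarrow> K \<noteq> {} \<Longrightarrow> supp d K \<in> borel_measurable M"
  by (intro continuous_imp_measurable_leb_Rd continuous_on_supp)

lemma measurable_dnorm [measurable]: "dnorm \<in> borel_measurable M"
  unfolding dnorm_def by (rule measurable_supp[OF dnorm_ball])

lemma measurable_dnorm_shift [measurable]: "(\<lambda>v. dnorm (\<lambda>i. v i + w i)) \<in> borel_measurable M"
  unfolding dnorm_def by (rule measurable_supp_shift[OF dnorm_ball])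

lemma dball_sets [measurable]: "dball r \<in> sets M"
  by measurable

lemma dball_finite: "emeasure M (dball r) < \<infinity>"
proof -
  let ?P = "PiE {..<d} (\<lambda>i. {- (N (unit i) * r)..N (unit i) * r})"
  have "dball r \<subseteq> ?P"
  proof
    fix v assume v: "v \<in> dball r"
    have "\<bar>v i\<bar> \<le> N (unit i) * r" if "i < d" for i
    proof -
      have "\<bar>v i\<bar> \<le> N (unit i) * dnorm v" by (rule abs_coord_le_dnorm[OF that])
      also have "\<dots> \<le> N (unit i) * r"
        using v N_unit_pos[OF that] by (intro mult_left_mono) auto
      finally show ?thesis .
    qed
    then show "v \<in> ?P"
      using v by (auto simp: leb_Rd_def space_PiM PiE_def abs_le_iff)
        (metis abs_le_iff minus_le_iff)
  qed
  then have "emeasure M (dball r) \<le> emeasure M ?P"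
    by (intro emeasure_mono) (auto simp: leb_Rd_def intro!: sets_PiM_I_finite)
  also have "\<dots> = (\<Prod>i<d. emeasure lborel {- (N (unit i) * r)..N (unit i) * r})"
    by (rule emeasure_leb_Rd_PiE) auto
  also have "\<dots> < \<infinity>"
    by (simp add: ennreal_prod_eq_top less_top[symmetric] emeasure_lborel_Icc_eq)
  finally show ?thesis .
qed

lemma dvol_scale:
  assumes "c > 0"
  shows "dvol c = c ^ d * dvol 1"
proof -
  have "emeasure M (dball (c * 1)) = ennreal (c ^ d) * emeasure M (dball 1)"
    by (rule emeasure_leb_Rd_dilate[OF assms measurable_dnorm])
       (auto intro: dnorm_cong simp: dnorm_scale assms less_imp_le)
  then show ?thesis
    using assms by (simp add: dvol_def measure_def enn2real_mult)
qed

lemma dvol_pos: "0 < dvol 1"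
proof -
  obtain c where c: "c > 0" "\<And>v. dnorm v \<le> c * (\<Sum>i<d. \<bar>v i\<bar>)"
    using dnorm_le_sum by blast
  \<comment> \<open>Half the side of a cube inside the dual unit ball, chosen so that
    \<open>c * (real d * a) = 1\<close>.\<close>
  define a where "a = 1 / (c * real d)"
  have a: "a > 0" using c d_ge by (simp add: a_def)
  let ?P = "PiE {..<d} (\<lambda>i. {- a..a})"
  have "?P \<subseteq> dball 1"
  proof
    fix v assume v: "v \<in> ?P"
    have "(\<Sum>i<d. \<bar>v i\<bar>) \<le> (\<Sum>i<d. a)"
      using v by (intro sum_mono) (auto simp: PiE_iff abs_le_iff minus_le_iff)
    then have "c * (\<Sum>i<d. \<bar>v i\<bar>) \<le> c * (real d * a)"
      using c by (intro mult_left_mono) auto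
    also have "\<dots> = 1" using c d_ge by (simp add: a_def)
    finally have "dnorm v \<le> 1" using c(2)[of v] by linarith
    then show "v \<in> dball 1" using v by (auto simp: leb_Rd_def space_PiM PiE_def)
  qed
  then have le: "emeasure M ?P \<le> emeasure M (dball 1)"
    by (intro emeasure_mono) auto
  have "emeasure M ?P = ennreal (2 * a) ^ d"
    using a by (subst emeasure_leb_Rd_PiE) auto
  then have "0 < emeasure M ?P"
    using a by (simp add: ennreal_power ennreal_zero_less_divide)
  from less_le_trans[OF this le] have "0 < emeasure M (dball 1)" .
  then show ?thesis
    using dball_finite[of 1] by (simp add: dvol_def measure_def enn2real_positive_iff)
qed

lemma integrable_supported:
  fixes f :: "(nat \<Rightarrow> real) \<Rightarrow> real"
  assumes [measurable]: "f \<in> borel_measurable M"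
    and "\<And>v. dnorm v \<le> R \<Longrightarrow> \<bar>f v\<bar> \<le> C" "\<And>v. dnorm v > R \<Longrightarrow> f v = 0"
  shows "integrable M f"
proof (rule Bochner_Integration.integrable_bound)
  show "integrable M (\<lambda>v. C * indicator (dball R) v :: real)"
    using dball_finite[of R] by (intro integrable_mult_right integrable_real_indicator) auto
  show "AE v in M. norm (f v) \<le> norm (C * indicator (dball R) v :: real)"
  proof (rule AE_I2)
    fix v assume "v \<in> space M"
    then show "norm (f v) \<le> norm (C * indicator (dball R) v :: real)"
      using assms(2,3)[of v] by (cases "dnorm v \<le> R") auto
  qed
qed fact

text \<open>A cone of height \<open>1\<close> over the dual unit ball, serving as an unnormalised
  density. It is \<open>1\<close>-Lipschitz for \<open>dnorm\<close> and concave inside the ball, so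
  its second differences can be positive only near the dual unit sphere.\<close>

definition rho :: "(nat \<Rightarrow> real) \<Rightarrow> real" where "rho v = max 0 (1 - dnorm v)"

lemma rho_bounds: "0 \<le> rho v" "rho v \<le> 1"
  using dnorm_nonneg[of v] by (auto simp: rho_def)

lemma rho_eq_0: "1 \<le> dnorm v \<Longrightarrow> rho v = 0"
  by (simp add: rho_def)

lemma rho_cong: "(\<And>i. i < d \<Longrightarrow> v i = w i) \<Longrightarrow> rho v = rho w"
  unfolding rho_def using dnorm_cong[of v w] by simp

lemma dnorm_le_add_shift: "dnorm v \<le> dnorm (\<lambda>i. v i + w i) + dnorm w"
  using dnorm_add[of "\<lambda>i. v i + w i" "\<lambda>i. - w i"] by (simp add: dnorm_minus)

lemma rho_shift_le: "rho (\<lambda>i. v i + w i) \<le> rho v + dnorm w"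
  using dnorm_le_add_shift[of v w] dnorm_nonneg[of w] by (simp add: rho_def)

lemma rho_shift_eq_0: "1 + dnorm w \<le> dnorm v \<Longrightarrow> rho (\<lambda>i. v i + w i) = 0"
  using dnorm_le_add_shift[of v w] by (intro rho_eq_0) simp

lemma measurable_rho_shift [measurable]: "(\<lambda>v. rho (\<lambda>i. v i + w i)) \<in> borel_measurable M"
  unfolding rho_def by measurable

lemma measurable_rho [measurable]: "rho \<in> borel_measurable M"
  using measurable_rho_shift[of "\<lambda>i. 0"] by simp

lemma supp_le_dnorm:
  assumes "bounded_Rd d K" "K \<noteq> {}"
  obtains H where "0 \<le> H" "\<And>v. \<bar>supp d K v\<bar> \<le> H * dnorm v"
proof -
  obtain B where B: "\<And>x i. x \<in> K \<Longrightarrow> i < d \<Longrightarrow> \<bar>x i\<bar> \<le> B"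
    using assms by (auto simp: bounded_Rd_def)
  let ?H = "\<bar>B\<bar> * (\<Sum>i<d. N (unit i))"
  show thesis
  proof
    show "0 \<le> ?H"
      by (intro mult_nonneg_nonneg sum_nonneg) (auto intro: less_imp_le N_unit_pos)
    fix v
    have "\<bar>supp d K v\<bar> \<le> \<bar>B\<bar> * (\<Sum>i<d. \<bar>v i\<bar>)"
    proof (rule supp_le_bound[OF assms(2)])
      fix x i assume "x \<in> K" "i < d"
      from B[OF this] show "\<bar>x i\<bar> \<le> \<bar>B\<bar>" by linarith
    qed
    also have "\<dots> \<le> \<bar>B\<bar> * (\<Sum>i<d. N (unit i) * dnorm v)"
      by (intro mult_left_mono sum_mono abs_coord_le_dnorm) auto
    finally show "\<bar>supp d K v\<bar> \<le> ?H * dnorm v"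
      by (simp add: sum_distrib_right mult.assoc)
  qed
qed

lemma integrable_supp_rho:
  assumes K: "bounded_Rd d K" "K \<noteq> {}"
  shows "integrable M (\<lambda>v. supp d K (\<lambda>i. v i + u i) * rho (\<lambda>i. v i + w i))"
proof -
  obtain H where H: "0 \<le> H" "\<And>v. \<bar>supp d K v\<bar> \<le> H * dnorm v"
    using supp_le_dnorm[OF K] by blast
  note [measurable] = measurable_supp_shift[OF K]
  show ?thesis
  proof (rule integrable_supported)
    fix v assume v: "dnorm v \<le> 1 + dnorm w"
    have "\<bar>supp d K (\<lambda>i. v i + u i)\<bar> \<le> H * dnorm (\<lambda>i. v i + u i)" by (rule H)
    also have "\<dots> \<le> H * (1 + dnorm w + dnorm u)"
      using v dnorm_add[of v u] H(1) by (intro mult_left_mono) auto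
    finally have "\<bar>supp d K (\<lambda>i. v i + u i)\<bar> * rho (\<lambda>i. v i + w i) \<le> H * (1 + dnorm w + dnorm u) * 1"
      using H(1) dnorm_nonneg[of u] dnorm_nonneg[of w] by (intro mult_mono rho_bounds) auto
    then show "\<bar>supp d K (\<lambda>i. v i + u i) * rho (\<lambda>i. v i + w i)\<bar> \<le> H * (1 + dnorm w + dnorm u)"
      by (simp add: abs_mult rho_bounds)
  next
    fix v assume "1 + dnorm w < dnorm v"
    then show "supp d K (\<lambda>i. v i + u i) * rho (\<lambda>i. v i + w i) = 0"
      by (simp add: rho_shift_eq_0)
  qed measurable
qed

lemma integrable_rho_shift: "integrable M (\<lambda>v. rho (\<lambda>i. v i + w i))"
proof (rule integrable_supported[where R = "1 + dnorm w" and C = 1])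
  fix v show "\<bar>rho (\<lambda>i. v i + w i)\<bar> \<le> 1"
    using rho_bounds[of "\<lambda>i. v i + w i"] by simp
qed (auto intro: rho_shift_eq_0)

lemma integral_rho_shift: "(\<integral>v. rho (\<lambda>i. v i + w i) \<partial>M) = (\<integral>v. rho v \<partial>M)"
  by (rule integral_leb_Rd_translate[OF measurable_rho]) (rule rho_cong)

text \<open>Placing the shift inside \<open>supp\<close> makes convexity and the comparison with
  \<open>supp d K w\<close> immediate; \<open>phi_alt\<close> moves it to
  \<open>rho\<close>.\<close>

definition phi :: "(nat \<Rightarrow> real) set \<Rightarrow> (nat \<Rightarrow> real) \<Rightarrow> real" where
  "phi K w = (\<integral>v. supp d K (\<lambda>i. v i + w i) * rho v \<partial>M)"

text \<open>Translation invariance moves the shift from the support function, about which little is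
  known, to the explicit function \<open>rho\<close>.\<close>

lemma phi_alt:
  assumes K: "bounded_Rd d K" "K \<noteq> {}"
  shows "phi K w = (\<integral>v. supp d K v * rho (\<lambda>i. v i + - w i) \<partial>M)"
proof -
  note [measurable] = measurable_supp[OF K]
  let ?f = "\<lambda>v. supp d K v * rho (\<lambda>i. v i + - w i)"
  have "(\<integral>v. ?f (\<lambda>i. v i + w i) \<partial>M) = (\<integral>v. ?f v \<partial>M)"
  proof (rule integral_leb_Rd_translate)
    show "?f \<in> borel_measurable M" by measurable
    fix u v :: "nat \<Rightarrow> real" assume "\<And>i. i < d \<Longrightarrow> u i = v i"
    then show "?f u = ?f v"
      using supp_cong[of d u v K] rho_cong[of "\<lambda>i. u i + - w i" "\<lambda>i. v i + - w i"] by simp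
  qed
  then show ?thesis by (simp add: phi_def)
qed

lemma phi_convex:
  assumes K: "bounded_Rd d K" "K \<noteq> {}" and t: "0 \<le> t" "t \<le> 1"
  shows "phi K (\<lambda>i. (1 - t) * u i + t * v i) \<le> (1 - t) * phi K u + t * phi K v"
proof -
  note int = integrable_supp_rho[OF K, of _ "\<lambda>i. 0", simplified]
  have "phi K (\<lambda>i. (1 - t) * u i + t * v i) \<le>
      (\<integral>x. (1 - t) * (supp d K (\<lambda>i. x i + u i) * rho x) + t * (supp d K (\<lambda>i. x i + v i) * rho x) \<partial>M)"
    unfolding phi_def
  proof (rule integral_mono)
    fix x :: "nat \<Rightarrow> real"
    have "supp d K (\<lambda>i. x i + ((1 - t) * u i + t * v i))
        = supp d K (\<lambda>i. (1 - t) * (x i + u i) + t * (x i + v i))"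
      by (rule arg_cong[where f = "supp d K"]) (auto simp: algebra_simps)
    also have "\<dots> \<le> supp d K (\<lambda>i. (1 - t) * (x i + u i)) + supp d K (\<lambda>i. t * (x i + v i))"
      by (rule supp_add_le[OF K])
    also have "\<dots> = (1 - t) * supp d K (\<lambda>i. x i + u i) + t * supp d K (\<lambda>i. x i + v i)"
      using supp_scale[OF K, of "1 - t" "\<lambda>i. x i + u i"] supp_scale[OF K, of t "\<lambda>i. x i + v i"] t
      by simp
    finally have "supp d K (\<lambda>i. x i + ((1 - t) * u i + t * v i)) * rho x
        \<le> ((1 - t) * supp d K (\<lambda>i. x i + u i) + t * supp d K (\<lambda>i. x i + v i)) * rho x"
      by (rule mult_right_mono) (rule rho_bounds)
    then show "supp d K (\<lambda>i. x i + ((1 - t) * u i + t * v i)) * rho x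
        \<le> (1 - t) * (supp d K (\<lambda>i. x i + u i) * rho x) + t * (supp d K (\<lambda>i. x i + v i) * rho x)"
      by (simp add: algebra_simps)
  qed (intro int Bochner_Integration.integrable_add integrable_mult_right)+
  also have "\<dots> = (1 - t) * phi K u + t * phi K v"
    unfolding phi_def by (subst Bochner_Integration.integral_add) (auto intro!: int)
  finally show ?thesis .
qed

text \<open>Three regions. Well inside the ball all three arguments have \<open>dnorm\<close> at
  most \<open>1\<close>, and concavity makes the difference nonpositive. Far outside all three
  values vanish. In the shell between, the Lipschitz bound is applied to each shift
  separately.\<close>

lemma rho_second_difference:
  "rho (\<lambda>i. v i + - w i) + rho (\<lambda>i. v i + w i) - 2 * rho v
     \<le> 2 * dnorm w * indicator {v. 1 - dnorm w < dnorm v \<and> dnorm v \<le> 1 + dnorm w} v"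
proof -
  let ?p = "dnorm (\<lambda>i. v i + w i)" and ?m = "dnorm (\<lambda>i. v i + - w i)"
  have conc: "2 * dnorm v \<le> ?p + ?m"
  proof -
    have "2 * dnorm v = dnorm (\<lambda>i. 2 * v i)" by (simp add: dnorm_scale)
    also have "\<dots> = dnorm (\<lambda>i. (v i + w i) + (v i + - w i))" by (simp add: algebra_simps)
    also have "\<dots> \<le> ?p + ?m" by (rule dnorm_add)
    finally show ?thesis .
  qed
  have pm: "?p \<le> dnorm v + dnorm w" "?m \<le> dnorm v + dnorm w"
    using dnorm_add[of v w] dnorm_add[of v "\<lambda>i. - w i"] by (auto simp: dnorm_minus)
  have mp: "dnorm v \<le> ?p + dnorm w" "dnorm v \<le> ?m + dnorm w"
    using dnorm_le_add_shift[of v w] dnorm_le_add_shift[of v "\<lambda>i. - w i"] by (auto simp: dnorm_minus)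
  consider "dnorm v \<le> 1 - dnorm w" | "1 - dnorm w < dnorm v" "dnorm v \<le> 1 + dnorm w" | "1 + dnorm w < dnorm v" by linarith
  then show ?thesis
  proof cases
    case 1
    then show ?thesis using conc pm dnorm_nonneg[of w] by (simp add: rho_def)
  next
    case 2
    have "rho (\<lambda>i. v i + w i) \<le> rho v + dnorm w" "rho (\<lambda>i. v i + - w i) \<le> rho v + dnorm w"
      using rho_shift_le[of v w] rho_shift_le[of v "\<lambda>i. - w i"] by (auto simp: dnorm_minus)
    then show ?thesis using 2 by simp
  next
    case 3
    then show ?thesis using mp dnorm_nonneg[of w] by (simp add: rho_def)
  qed
qed

end

section \<open>The Steiner point\<close>

context normed_Rd
begin

text \<open>
  The integral of the second difference \<open>\<Delta>\<close> of \<^term>\<open>rho\<close> vanishes, so adding the constant \<open>2 * H\<close> to the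
  support function changes nothing and makes it nonnegative; then only the positive part of \<open>\<Delta>\<close>
  counts, and it lives on a thin shell around the dual unit sphere.
\<close>

lemma phi_second_difference_le:
  assumes K: "bounded_Rd d K" "K \<noteq> {}"
    and H: "0 \<le> H" "\<And>v. \<bar>supp d K v\<bar> \<le> H * dnorm v" and w: "dnorm w < 1"
  shows "phi K w + phi K (\<lambda>i. - w i) - 2 * phi K (\<lambda>i. 0)
      \<le> 8 * H * dnorm w * ((1 + dnorm w) ^ d - (1 - dnorm w) ^ d) * dvol 1"
proof -
  let ?h = "supp d K" and ?e = "dnorm w"
  define \<Delta> where "\<Delta> v = rho (\<lambda>i. v i + - w i) + rho (\<lambda>i. v i + w i) - 2 * rho v" for v
  have int0: "integrable M (\<lambda>v. rho (\<lambda>i. v i + u i))" for u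
    by (rule integrable_rho_shift)
  have inth: "integrable M (\<lambda>v. ?h v * rho (\<lambda>i. v i + u i))" for u
    using integrable_supp_rho[OF K, of "\<lambda>i. 0" u] by simp
  note ints = int0 inth int0[of "\<lambda>i. 0", simplified] inth[of "\<lambda>i. 0", simplified]
  have int_\<Delta>: "integrable M \<Delta>" "integrable M (\<lambda>v. ?h v * \<Delta> v)"
    unfolding \<Delta>_def ring_distribs mult.left_commute[of _ 2]
    by (intro Bochner_Integration.integrable_add Bochner_Integration.integrable_diff
        integrable_mult_right ints)+
  have mean: "(\<integral>v. \<Delta> v \<partial>M) = 0"
    unfolding \<Delta>_def
    by (simp add: ints int0[of "\<lambda>i. - w i", simplified] integral_rho_shift integral_rho_shift[of "\<lambda>i. - w i", simplified])
  have "phi K w + phi K (\<lambda>i. - w i) - 2 * phi K (\<lambda>i. 0) = (\<integral>v. ?h v * \<Delta> v \<partial>M)"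
    unfolding \<Delta>_def ring_distribs mult.left_commute[of _ 2] phi_alt[OF K]
    by (simp add: ints inth[of "\<lambda>i. - w i", simplified])
  also have "\<dots> = (\<integral>v. ?h v * \<Delta> v \<partial>M) + 2 * H * (\<integral>v. \<Delta> v \<partial>M)"
    using mean by simp
  also have "\<dots> = (\<integral>v. (?h v + 2 * H) * \<Delta> v \<partial>M)"
    by (simp add: ring_distribs int_\<Delta>)
  also have "\<dots> \<le> (\<integral>v. 8 * H * ?e * indicator (dball (1 + ?e) - dball (1 - ?e)) v \<partial>M)"
  proof (rule integral_mono)
    show "integrable M (\<lambda>v. (?h v + 2 * H) * \<Delta> v)"
      unfolding ring_distribs by (intro Bochner_Integration.integrable_add integrable_mult_right int_\<Delta>)
    have "emeasure M (dball (1 + ?e) - dball (1 - ?e)) \<le> emeasure M (dball (1 + ?e))"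
      by (intro emeasure_mono) auto
    also have "\<dots> < \<infinity>" by (rule dball_finite)
    finally show "integrable M (\<lambda>v. 8 * H * ?e * indicator (dball (1 + ?e) - dball (1 - ?e)) v :: real)"
      by (intro integrable_mult_right integrable_real_indicator) auto
    fix v assume v: "v \<in> space M"
    show "(?h v + 2 * H) * \<Delta> v \<le> 8 * H * ?e * indicator (dball (1 + ?e) - dball (1 - ?e)) v"
    proof (cases "dnorm v \<le> 1 + ?e")
      case False
      then have "\<Delta> v = 0"
        using rho_shift_eq_0[of w v] rho_shift_eq_0[of "\<lambda>i. - w i" v] rho_eq_0[of v] dnorm_nonneg[of w]
        by (simp add: \<Delta>_def dnorm_minus)
      then show ?thesis using H(1) dnorm_nonneg[of w] by simp
    next
      case True
      \<comment> \<open>Here \<open>dnorm v\<close> is at most \<open>1 + ?e < 2\<close>, so the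
        lifted support function lies between \<open>0\<close> and \<open>4 * H\<close>. Multiplied
        by the factor \<open>2 * ?e\<close> from the second difference this yields the constant
        \<open>8\<close>.\<close>
      have "\<bar>?h v\<bar> \<le> H * 2"
        by (rule order.trans[OF H(2)], rule mult_left_mono) (use True w H(1) in auto)
      then have h: "0 \<le> ?h v + 2 * H" "?h v + 2 * H \<le> 4 * H" by auto
      let ?i = "indicator (dball (1 + ?e) - dball (1 - ?e)) v :: real"
      have "\<Delta> v \<le> 2 * ?e * ?i"
        using rho_second_difference[of v w] v
        by (auto simp: \<Delta>_def indicator_def split: if_splits)
      then have "(?h v + 2 * H) * \<Delta> v \<le> (?h v + 2 * H) * (2 * ?e * ?i)"
        by (rule mult_left_mono) (rule h)
      also have "\<dots> \<le> (4 * H) * (2 * ?e * ?i)"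
        by (rule mult_right_mono[OF h(2)]) (simp add: dnorm_nonneg)
      finally show ?thesis by simp
    qed
  qed
  also have "\<dots> = 8 * H * ?e * measure M (dball (1 + ?e) - dball (1 - ?e))"
    by simp
  also have "measure M (dball (1 + ?e) - dball (1 - ?e)) = dvol (1 + ?e) - dvol (1 - ?e)"
    unfolding dvol_def using dball_finite[of "1 + ?e", THEN less_imp_neq] dnorm_nonneg[of w]
    by (intro measure_Diff) auto
  also have "\<dots> = ((1 + ?e) ^ d - (1 - ?e) ^ d) * dvol 1"
    using w dnorm_nonneg[of w] dvol_scale[of "1 + ?e"] dvol_scale[of "1 - ?e"] by (simp add: algebra_simps)
  finally show ?thesis by (simp add: mult.assoc)
qed

text \<open>Convexity bounds the quotient below by \<open>0\<close>. Above, the second difference is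
  at most \<open>e\<close> times a quantity proportional to the volume of a shell that shrinks with
  \<open>e\<close>, so the quotient is squeezed to \<open>0\<close>.\<close>

lemma phi_smooth:
  assumes K: "bounded_Rd d K" "K \<noteq> {}"
  shows "((\<lambda>e. (phi K (\<lambda>i. e * w i) + phi K (\<lambda>i. - e * w i) - 2 * phi K (\<lambda>i. 0)) / e) \<longlongrightarrow> 0) (at_right 0)"
proof -
  obtain H where H: "0 \<le> H" "\<And>v. \<bar>supp d K v\<bar> \<le> H * dnorm v"
    using supp_le_dnorm[OF K] by blast
  let ?s = "\<lambda>e. phi K (\<lambda>i. e * w i) + phi K (\<lambda>i. - e * w i) - 2 * phi K (\<lambda>i. 0)"
  let ?b = "\<lambda>e. 8 * H * dnorm w * ((1 + e * dnorm w) ^ d - (1 - e * dnorm w) ^ d) * dvol 1"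
  have "(?b \<longlongrightarrow> 8 * H * dnorm w * ((1 + 0 * dnorm w) ^ d - (1 - 0 * dnorm w) ^ d) * dvol 1) (at_right 0)"
    by (intro tendsto_intros)
  then have lim: "(?b \<longlongrightarrow> 0) (at_right 0)" by simp
  \<comment> \<open>On this interval \<open>e * dnorm w < 1\<close>, as
    \<open>phi_second_difference_le\<close> requires.\<close>
  have ev: "eventually (\<lambda>e. e \<in> {0<..<1 / (dnorm w + 1)}) (at_right 0)"
    using dnorm_nonneg[of w] by (intro eventually_at_right_real) auto
  show ?thesis
  proof (rule tendsto_sandwich[OF _ _ tendsto_const lim])
    show "eventually (\<lambda>e. 0 \<le> ?s e / e) (at_right 0)"
      using ev
    proof (rule eventually_mono)
      fix e assume e: "e \<in> {0<..<1 / (dnorm w + 1)}"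
      have "phi K (\<lambda>i. (1 - 1/2) * (e * w i) + 1/2 * (- e * w i))
          \<le> (1 - 1/2) * phi K (\<lambda>i. e * w i) + 1/2 * phi K (\<lambda>i. - e * w i)"
        by (rule phi_convex[OF K]) auto
      then show "0 \<le> ?s e / e" using e by simp
    qed
    show "eventually (\<lambda>e. ?s e / e \<le> ?b e) (at_right 0)"
      using ev
    proof (rule eventually_mono)
      fix e assume e: "e \<in> {0<..<1 / (dnorm w + 1)}"
      then have "e * (dnorm w + 1) < 1" using dnorm_nonneg[of w] by (simp add: field_simps)
      then have De: "dnorm (\<lambda>i. e * w i) = e * dnorm w" "e * dnorm w < 1"
        using e by (auto simp: dnorm_scale algebra_simps)
      have "?s e \<le> e * ?b e"
        using phi_second_difference_le[OF K H, of "\<lambda>i. e * w i"] De by (simp add: algebra_simps)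
      then show "?s e / e \<le> ?b e" using e by (simp add: field_simps)
    qed
  qed
qed

text \<open>The gradient of \<open>phi K\<close> at \<open>0\<close>, described by one-sided
  directional derivatives because \<open>gradient_exists\<close> delivers these.\<close>

definition is_gradient :: "(nat \<Rightarrow> real) set \<Rightarrow> (nat \<Rightarrow> real) \<Rightarrow> bool" where
  "is_gradient K s \<longleftrightarrow> s \<in> Rd d \<and>
     (\<forall>w. ((\<lambda>e. (phi K (\<lambda>i. e * w i) - phi K (\<lambda>i. 0)) / e) \<longlongrightarrow> dot d w s) (at_right 0))"

definition phi_grad :: "(nat \<Rightarrow> real) set \<Rightarrow> (nat \<Rightarrow> real)" where
  "phi_grad K = (SOME s. is_gradient K s)"

lemma phi_grad_gradient:
  assumes K: "bounded_Rd d K" "K \<noteq> {}"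
  shows "phi_grad K \<in> Rd d"
    "((\<lambda>e. (phi K (\<lambda>i. e * w i) - phi K (\<lambda>i. 0)) / e) \<longlongrightarrow> dot d w (phi_grad K)) (at_right 0)"
proof -
  have "phi K u = phi K v" if "\<And>i. i < d \<Longrightarrow> u i = v i" for u v
    unfolding phi_def
    by (intro Bochner_Integration.integral_cong refl arg_cong2[where f = "(*)"] supp_cong) (simp add: that)
  then obtain s where "is_gradient K s"
    unfolding is_gradient_def
    by (rule gradient_exists[of d "phi K", OF _ phi_convex[OF K] phi_smooth[OF K]]) auto
  then have "is_gradient K (phi_grad K)" unfolding phi_grad_def by (rule someI[of "is_gradient K"])
  then show "phi_grad K \<in> Rd d"
    "((\<lambda>e. (phi K (\<lambda>i. e * w i) - phi K (\<lambda>i. 0)) / e) \<longlongrightarrow> dot d w (phi_grad K)) (at_right 0)"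
    by (auto simp: is_gradient_def)
qed

definition rho_mass :: real where "rho_mass = (\<integral>v. rho v \<partial>M)"

text \<open>On the dual ball of radius \<open>q\<close> the cone has height at least
  \<open>1 - q = 1 / (real d + 1)\<close>, and the volume lost by shrinking the ball is compensated
  by \<open>(1 + 1 / real d) ^ d\<close>. Hence the mass is at least of order the ball volume
  divided by \<open>d\<close>.\<close>

lemma rho_mass_lower: "dvol 1 \<le> rho_mass * (real d + 1) * (1 + 1 / real d) ^ d"
proof -
  \<comment> \<open>This radius maximises \<open>(1 - q) * q ^ d\<close>, the bound that a ball of
    radius \<open>q\<close> provides relative to \<open>dvol 1\<close>.\<close>
  define q where "q = real d / (real d + 1)"
  have dp: "0 < real d" using d_ge by simp
  then have "1 + 1 / real d = (real d + 1) / real d" by (simp add: field_simps)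
  then have q: "0 < q" "(1 + 1 / real d) * q = 1"
    using dp by (simp_all add: q_def)
  have "(\<integral>v. 1 / (real d + 1) * indicator (dball q) v \<partial>M) \<le> rho_mass"
    unfolding rho_mass_def
  proof (rule integral_mono)
    show "integrable M (\<lambda>v. 1 / (real d + 1) * indicator (dball q) v :: real)"
      using dball_finite[of q] by (intro integrable_mult_right integrable_real_indicator) auto
    show "integrable M rho" using integrable_rho_shift[of "\<lambda>i. 0"] by simp
    fix v
    have "1 - q = 1 / (real d + 1)" by (simp add: q_def field_simps)
    then show "1 / (real d + 1) * indicator (dball q) v \<le> rho v"
      by (auto simp: rho_def indicator_def)
  qed
  then have "1 / (real d + 1) * (q ^ d * dvol 1) \<le> rho_mass"
    using dvol_scale[OF q(1)] by (simp add: dvol_def)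
  then have "q ^ d * dvol 1 \<le> rho_mass * (real d + 1)" by (simp add: field_simps)
  then have "(q ^ d * dvol 1) * (1 + 1 / real d) ^ d \<le> (rho_mass * (real d + 1)) * (1 + 1 / real d) ^ d"
    by (rule mult_right_mono) simp
  moreover have "(q ^ d * dvol 1) * (1 + 1 / real d) ^ d = dvol 1"
  proof -
    have "(q ^ d * dvol 1) * (1 + 1 / real d) ^ d = ((1 + 1 / real d) * q) ^ d * dvol 1"
      by (simp only: power_mult_distrib ac_simps)
    then show ?thesis by (simp only: q power_one mult_1)
  qed
  ultimately show ?thesis by simp
qed

lemma rho_mass_pos: "0 < rho_mass"
proof -
  have "0 < rho_mass * ((real d + 1) * (1 + 1 / real d) ^ d)"
    using rho_mass_lower dvol_pos by (simp add: mult.assoc)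
  moreover have "0 \<le> (real d + 1) * (1 + 1 / real d) ^ d" by simp
  ultimately show ?thesis by (metis not_less zero_less_mult_pos2 mult_nonpos_nonneg not_le)
qed

text \<open>Sublinearity of the support function bounds every difference quotient of
  \<open>phi K\<close> in the direction \<open>w\<close> by the right-hand side, and the bound
  survives the limit.\<close>

lemma dot_phi_grad_le:
  assumes K: "bounded_Rd d K" "K \<noteq> {}"
  shows "dot d w (phi_grad K) \<le> rho_mass * supp d K w"
proof (rule tendsto_upperbound[OF phi_grad_gradient(2)[OF K]])
  note int = integrable_supp_rho[OF K, of _ "\<lambda>i. 0", simplified]
  note int0 = int[of "\<lambda>i. 0", simplified] integrable_rho_shift[of "\<lambda>i. 0", simplified]
  show "eventually (\<lambda>e. (phi K (\<lambda>i. e * w i) - phi K (\<lambda>i. 0)) / e \<le> rho_mass * supp d K w) (at_right 0)"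
    unfolding eventually_at_filter
  proof (intro always_eventually allI impI)
    fix e :: real assume "e \<in> {0<..}"
    then have e: "0 < e" by simp
    have "phi K (\<lambda>i. e * w i) \<le> (\<integral>v. supp d K v * rho v + e * supp d K w * rho v \<partial>M)"
      unfolding phi_def
    proof (rule integral_mono)
      fix v :: "nat \<Rightarrow> real"
      have "supp d K (\<lambda>i. v i + e * w i) \<le> supp d K v + e * supp d K w"
        using supp_add_le[OF K, of v "\<lambda>i. e * w i"] supp_scale[OF K, of e w] e by simp
      from mult_right_mono[OF this rho_bounds(1)[of v]]
      show "supp d K (\<lambda>i. v i + e * w i) * rho v \<le> supp d K v * rho v + e * supp d K w * rho v"
        by (simp add: algebra_simps)
    qed (intro int Bochner_Integration.integrable_add integrable_mult_right int0)+
    also have "\<dots> = phi K (\<lambda>i. 0) + e * supp d K w * rho_mass"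
      using int0 by (simp add: phi_def rho_mass_def)
    finally show "(phi K (\<lambda>i. e * w i) - phi K (\<lambda>i. 0)) / e \<le> rho_mass * supp d K w"
      using e by (simp add: field_simps)
  qed
qed simp

text \<open>The division by the mass makes this a generalised Steiner point: for a singleton with
  point \<open>x\<close> in \<open>Rd d\<close>, the gradient of \<open>phi\<close> is
  \<open>rho_mass\<close> times \<open>x\<close>, so the result is \<open>x\<close> itself.\<close>

definition steiner :: "(nat \<Rightarrow> real) set \<Rightarrow> (nat \<Rightarrow> real)" where
  "steiner K = (\<lambda>i. (1 / rho_mass) * phi_grad K i)"

lemma steiner_in:
  assumes "closed K" "K \<subseteq> Rd d" "convex_in_Rd K" and K: "bounded_Rd d K" "K \<noteq> {}"
  shows "steiner K \<in> K"
proof (rule mem_of_dot_le_supp[OF assms(1-3) K(2)])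
  show "steiner K \<in> Rd d"
    unfolding steiner_def using phi_grad_gradient(1)[OF K] by (intro Rd_lin)
  show "dot d w (steiner K) \<le> supp d K w" for w
    unfolding steiner_def dot_scale_right using dot_phi_grad_le[OF K, of w] rho_mass_pos by (simp add: field_simps)
qed

text \<open>
  The radius \<open>1 + 1 / d\<close> leaves room for small translates of the support of \<^term>\<open>rho\<close>, and costs only a
  constant factor because \<open>(1 + 1 / d) ^ d \<le> exp 1\<close>.
\<close>

definition energy :: "(nat \<Rightarrow> real) \<Rightarrow> (nat \<Rightarrow> real) set \<Rightarrow> real" where
  "energy x0 K = (\<integral>v. (supp d K v - dot d v x0) * indicator (dball (1 + 1 / real d)) v \<partial>M) / rho_mass"

text \<open>Subtracting \<open>dot d v x0\<close> recentres the body at \<open>x0\<close>, so the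
  bound depends on the radius and not on the position. In differences of \<open>energy\<close> the
  subtracted term cancels.\<close>

lemma supp_minus_dot_le:
  assumes "x0 \<in> Rd d" "K \<subseteq> nball x0 r" "K \<noteq> {}"
  shows "\<bar>supp d K v - dot d v x0\<bar> \<le> r * dnorm v"
proof -
  have b: "bounded_Rd d K" using bounded_Rd_subset[OF bounded_nball[OF assms(1)] assms(2)] .
  have *: "\<bar>dot d v x - dot d v x0\<bar> \<le> r * dnorm v" if "x \<in> K" for x
  proof -
    have x: "x \<in> Rd d" "N (\<lambda>i. x i - x0 i) \<le> r" "N (\<lambda>i. x0 i - x i) \<le> r"
      using that assms N_diff_commute[of x x0] by (auto simp: nball_def)
    have "dot d v (\<lambda>i. x i - x0 i) \<le> r * dnorm v"
      using dot_le_dnorm[OF Rd_lin(2)[OF x(1) assms(1)], of v] mult_right_mono[OF x(2) dnorm_nonneg[of v]]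
      by linarith
    moreover have "dot d v (\<lambda>i. x0 i - x i) \<le> r * dnorm v"
      using dot_le_dnorm[OF Rd_lin(2)[OF assms(1) x(1)], of v] mult_right_mono[OF x(3) dnorm_nonneg[of v]]
      by linarith
    ultimately show ?thesis by (auto simp: dot_diff_right)
  qed
  have "supp d K v \<le> dot d v x0 + r * dnorm v"
  proof (rule supp_least[OF assms(3)])
    show "dot d v x \<le> dot d v x0 + r * dnorm v" if "x \<in> K" for x using *[OF that] by linarith
  qed
  moreover obtain x where x: "x \<in> K" using assms(3) by auto
  ultimately show ?thesis using *[OF x] dot_le_supp[OF b x, of v] by linarith
qed

lemma measurable_dot: "(\<lambda>v. dot d v x0) \<in> borel_measurable M"
  unfolding dot_commute[of d _ x0]
  by (intro continuous_imp_measurable_leb_Rd) (rule continuous_on_dot_right)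

lemma integrable_energy:
  assumes x0: "x0 \<in> Rd d" and K: "K \<subseteq> nball x0 r" "K \<noteq> {}"
  shows "integrable M (\<lambda>v. (supp d K v - dot d v x0) * indicator (dball R) v)"
proof -
  have b: "bounded_Rd d K" using bounded_Rd_subset[OF bounded_nball[OF x0] K(1)] .
  note [measurable] = measurable_supp[OF b K(2)] measurable_dot
  show ?thesis
  proof (rule integrable_supported[where R = R and C = "\<bar>r\<bar> * \<bar>R\<bar>"])
    fix v assume v: "dnorm v \<le> R"
    have "\<bar>supp d K v - dot d v x0\<bar> \<le> r * dnorm v" by (rule supp_minus_dot_le[OF x0 K])
    also have "\<dots> \<le> \<bar>r\<bar> * \<bar>R\<bar>" using v dnorm_nonneg[of v] by (intro mult_mono) auto
    finally show "\<bar>(supp d K v - dot d v x0) * indicator (dball R) v\<bar> \<le> \<bar>r\<bar> * \<bar>R\<bar>"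
      by (auto simp: indicator_def)
  qed auto
qed

text \<open>The factor \<open>2\<close> bounds the enlarged radius \<open>1 + 1 / real d\<close>.
  One factor \<open>exp 1\<close> comes from the volume of the enlarged ball, the other and
  \<open>real d + 1\<close> come from \<open>rho_mass_lower\<close>.\<close>

definition chase_const :: real where "chase_const = 2 * exp 2 * (real d + 1)"

lemma chase_const_pos: "0 < chase_const"
  by (simp add: chase_const_def)

lemma abs_energy_le:
  assumes x0: "x0 \<in> Rd d" and K: "K \<subseteq> nball x0 r" "K \<noteq> {}" and r: "0 \<le> r"
  shows "\<bar>energy x0 K\<bar> \<le> chase_const * r"
proof -
  let ?R = "1 + 1 / real d"
  let ?f = "\<lambda>v. (supp d K v - dot d v x0) * indicator (dball ?R) v"
  have "\<bar>\<integral>v. ?f v \<partial>M\<bar> \<le> (\<integral>v. \<bar>?f v\<bar> \<partial>M)"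
    by (rule integral_abs_bound)
  also have "\<dots> \<le> (\<integral>v. 2 * r * indicator (dball ?R) v \<partial>M)"
  proof (rule integral_mono)
    show "integrable M (\<lambda>v. \<bar>?f v\<bar>)" by (intro integrable_abs integrable_energy[OF x0 K])
    show "integrable M (\<lambda>v. 2 * r * indicator (dball ?R) v :: real)"
      using dball_finite[of ?R] by (intro integrable_mult_right integrable_real_indicator) auto
    fix v
    show "\<bar>?f v\<bar> \<le> 2 * r * indicator (dball ?R) v"
    proof (cases "v \<in> dball ?R")
      case True
      have "?R \<le> 2" using d_ge by simp
      then have "dnorm v \<le> 2" using True by auto
      then have "r * dnorm v \<le> r * 2" using r by (rule mult_left_mono)
      then show ?thesis using supp_minus_dot_le[OF x0 K, of v] True by simp
    qed simp
  qed
  also have "\<dots> = 2 * r * dvol ?R" by (simp add: dvol_def)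
  also have "dvol ?R = ?R ^ d * dvol 1" using dvol_scale[of ?R] by (simp add: add_pos_nonneg)
  also have "2 * r * (?R ^ d * dvol 1) \<le> 2 * r * (?R ^ d * (rho_mass * (real d + 1) * ?R ^ d))"
    using r rho_mass_lower by (intro mult_left_mono) auto
  also have "\<dots> = 2 * r * rho_mass * (real d + 1) * (?R ^ d)\<^sup>2"
    by (simp add: power2_eq_square)
  also have "\<dots> \<le> 2 * r * rho_mass * (real d + 1) * (exp 1)\<^sup>2"
  proof (intro mult_left_mono power_mono)
    have "?R ^ d \<le> exp (1 / real d) ^ d"
      using exp_ge_add_one_self[of "1 / real d"] by (intro power_mono) auto
    also have "\<dots> = exp 1" using d_ge by (simp flip: exp_of_nat_mult)
    finally show "?R ^ d \<le> exp 1" .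
  qed (use r rho_mass_pos in auto)
  also have "(exp 1)\<^sup>2 = (exp 2 :: real)"
    by (simp flip: exp_of_nat_mult)
  finally show ?thesis using rho_mass_pos by (simp add: energy_def chase_const_def field_simps)
qed

text \<open>With the shift moved to \<open>rho\<close>, the difference of the two directional
  derivatives is a limit of integrals of the nonnegative gap \<open>supp d K v - supp d L v\<close>
  against difference quotients of \<open>rho\<close>. These are at most \<open>dnorm w\<close> and,
  for small shifts, at most \<open>0\<close> outside the enlarged dual ball, so the energy drop
  bounds every pairing with \<open>w\<close>, and the bidual bound turns this into a bound for
  \<open>N\<close>.\<close>

lemma steiner_movement:
  assumes x0: "x0 \<in> Rd d" and K: "K \<subseteq> nball x0 r" and L: "L \<subseteq> K" "L \<noteq> {}"
  shows "N (\<lambda>i. steiner L i - steiner K i) \<le> energy x0 K - energy x0 L"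
proof -
  have bK: "bounded_Rd d K" "K \<noteq> {}"
    using bounded_Rd_subset[OF bounded_nball[OF x0] K] L by auto
  have bL: "bounded_Rd d L" "L \<noteq> {}"
    using bounded_Rd_subset[OF bK(1) L(1)] L by auto
  have Lr: "L \<subseteq> nball x0 r" using K L by auto
  let ?R = "1 + 1 / real d"
  let ?i = "indicator (dball ?R) :: (nat \<Rightarrow> real) \<Rightarrow> real"
  define P where "P = (\<integral>v. (supp d K v - supp d L v) * ?i v \<partial>M)"
  have eq: "(supp d K v - supp d L v) * ?i v
      = (supp d K v - dot d v x0) * ?i v - (supp d L v - dot d v x0) * ?i v" for v
    by (simp add: algebra_simps)
  have intP: "integrable M (\<lambda>v. (supp d K v - supp d L v) * ?i v)"
    unfolding eq by (intro Bochner_Integration.integrable_diff integrable_energy[OF x0 K bK(2)] integrable_energy[OF x0 Lr bL(2)])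
  have FP: "energy x0 K - energy x0 L = P / rho_mass"
    unfolding energy_def P_def eq
    using integrable_energy[OF x0 K bK(2)] integrable_energy[OF x0 Lr bL(2)]
    by (simp add: diff_divide_distrib)
  have mono: "supp d L v \<le> supp d K v" for v
    using supp_mono[OF bK(1) L(2,1)] .
  have P0: "0 \<le> P"
    unfolding P_def by (intro integral_nonneg_AE AE_I2) (simp add: mono)
  have le: "dot d w (\<lambda>i. phi_grad K i - phi_grad L i) \<le> P * dnorm w" for w
  proof -
    let ?q = "\<lambda>K e. (phi K (\<lambda>i. e * w i) - phi K (\<lambda>i. 0)) / e"
    have lim: "((\<lambda>e. ?q K e - ?q L e) \<longlongrightarrow> dot d w (phi_grad K) - dot d w (phi_grad L)) (at_right 0)"
      by (intro tendsto_diff phi_grad_gradient bK bL)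
    \<comment> \<open>For such \<open>e\<close> the shift satisfies
      \<open>e * dnorm w \<le> 1 / real d\<close>, so the translated \<open>rho\<close> vanishes
      outside the dual ball of radius \<open>?R\<close>.\<close>
    have ev: "eventually (\<lambda>e. e \<in> {0<..<1 / (real d * (dnorm w + 1))}) (at_right 0)"
      using dnorm_nonneg[of w] d_ge by (intro eventually_at_right_real) auto
    have "dot d w (phi_grad K) - dot d w (phi_grad L) \<le> P * dnorm w"
    proof (rule tendsto_upperbound[OF lim])
      show "eventually (\<lambda>e. ?q K e - ?q L e \<le> P * dnorm w) (at_right 0)"
        using ev
      proof (rule eventually_mono)
        fix e assume e: "e \<in> {0<..<1 / (real d * (dnorm w + 1))}"
        have "0 < real d * (dnorm w + 1)" using dnorm_nonneg[of w] d_ge by simp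
        with e have "e * (real d * (dnorm w + 1)) < 1" by (simp only: greaterThanLessThan_iff pos_less_divide_eq)
        then have "real d * (e * (dnorm w + 1)) < 1" by (simp only: ac_simps)
        then have "real d * (e * dnorm w) \<le> 1"
          using e d_ge by (simp add: ring_distribs) (smt (verit) mult_nonneg_nonneg of_nat_0_le_iff)
        then have De: "e * dnorm w \<le> 1 / real d" using d_ge by (simp add: field_simps)
        have Dw: "dnorm (\<lambda>i. - (e * w i)) = e * dnorm w"
          using e dnorm_minus[of "\<lambda>i. e * w i"] by (simp add: dnorm_scale)
        have ints: "integrable M (\<lambda>v. supp d K v * rho (\<lambda>i. v i + u i))"
          "integrable M (\<lambda>v. supp d L v * rho (\<lambda>i. v i + u i))" for u
          using integrable_supp_rho[OF bK, of "\<lambda>i. 0" u] integrable_supp_rho[OF bL, of "\<lambda>i. 0" u] by auto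
        note ints' = ints[of "\<lambda>i. - (e * w i)"] ints[of "\<lambda>i. 0"]
        let ?g = "\<lambda>K v. supp d K v * rho (\<lambda>i. v i + - (e * w i)) - supp d K v * rho (\<lambda>i. v i + 0)"
        have gi: "integrable M (?g K)" "integrable M (?g L)"
          by (intro Bochner_Integration.integrable_diff ints')+
        have "(phi K (\<lambda>i. e * w i) - phi K (\<lambda>i. 0)) - (phi L (\<lambda>i. e * w i) - phi L (\<lambda>i. 0))
            = (\<integral>v. ?g K v \<partial>M) - (\<integral>v. ?g L v \<partial>M)"
          using ints' by (simp add: phi_alt[OF bK] phi_alt[OF bL])
        also have "\<dots> = (\<integral>v. ?g K v - ?g L v \<partial>M)"
          by (rule Bochner_Integration.integral_diff[OF gi, symmetric])
        also have "\<dots> \<le> (\<integral>v. (e * dnorm w) * ((supp d K v - supp d L v) * ?i v) \<partial>M)"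
        proof (rule integral_mono)
          fix v assume v: "v \<in> space M"
          \<comment> \<open>An upper bound suffices since the factor
            \<open>supp d K v - supp d L v\<close> is nonnegative: inside the ball it is the
            Lipschitz property, outside the shifted term is \<open>0\<close> and
            \<open>rho v\<close> is nonnegative.\<close>
          have "rho (\<lambda>i. v i + - (e * w i)) - rho v \<le> e * dnorm w * ?i v"
          proof (cases "dnorm v \<le> ?R")
            case True
            then show ?thesis using rho_shift_le[of v "\<lambda>i. - (e * w i)"] Dw v by simp
          next
            case False
            then show ?thesis
              using rho_shift_eq_0[of "\<lambda>i. - (e * w i)" v] De Dw rho_bounds(1)[of v] by simp
          qed
          then have "(supp d K v - supp d L v) * (rho (\<lambda>i. v i + - (e * w i)) - rho v)
              \<le> (supp d K v - supp d L v) * (e * dnorm w * ?i v)"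
            by (rule mult_left_mono) (simp add: mono)
          then show "?g K v - ?g L v \<le> (e * dnorm w) * ((supp d K v - supp d L v) * ?i v)"
            by (simp add: algebra_simps)
        qed (intro Bochner_Integration.integrable_diff integrable_mult_right gi intP)+
        also have "\<dots> = e * dnorm w * P" by (simp add: P_def)
        finally have "((phi K (\<lambda>i. e * w i) - phi K (\<lambda>i. 0)) - (phi L (\<lambda>i. e * w i) - phi L (\<lambda>i. 0))) / e
            \<le> P * dnorm w"
          using e by (simp add: pos_divide_le_eq ac_simps)
        then show "?q K e - ?q L e \<le> P * dnorm w" by (simp only: diff_divide_distrib)
      qed
    qed simp
    then show ?thesis by (simp add: dot_diff_right)
  qed
  have Gr: "phi_grad K \<in> Rd d" "phi_grad L \<in> Rd d" using phi_grad_gradient(1) bK bL by auto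
  have "N (\<lambda>i. phi_grad K i - phi_grad L i) \<le> P"
    by (rule N_le_of_dot_le_dnorm[OF Rd_lin(2)[OF Gr] P0 le])
  then have "N (\<lambda>i. phi_grad L i - phi_grad K i) \<le> P"
    using N_diff_commute[OF Gr] by simp
  moreover have "(\<lambda>i. steiner L i - steiner K i) = (\<lambda>i. (1 / rho_mass) * (phi_grad L i - phi_grad K i))"
    by (simp add: steiner_def diff_divide_distrib)
  ultimately show ?thesis
    using rho_mass_pos N_scale[OF Rd_lin(2)[OF Gr(2,1)], of "1 / rho_mass"] by (simp add: FP divide_right_mono)
qed

end

section \<open>The algorithm\<close>

text \<open>For positive \<open>x\<close> this is the least power of two with integer exponent that
  is at least \<open>x\<close>. Other arguments only yield some positive number, and distance zero
  is treated separately below.\<close>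

definition dyadic_ceiling :: "real \<Rightarrow> real" where
  "dyadic_ceiling x = 2 powr \<lceil>log 2 x\<rceil>"

lemma dyadic_ceiling_pos: "0 < dyadic_ceiling x"
  by (simp add: dyadic_ceiling_def)

lemma dyadic_ceiling_ge: "0 < x \<Longrightarrow> x \<le> dyadic_ceiling x"
  unfolding dyadic_ceiling_def
  using powr_mono[OF le_of_int_ceiling[of "log 2 x"], of 2] by simp

lemma dyadic_ceiling_le:
  assumes "0 < x"
  shows "dyadic_ceiling x \<le> 2 * x"
proof -
  have "2 powr \<lceil>log 2 x\<rceil> \<le> 2 powr (log 2 x + 1)"
    by (intro powr_mono) (auto simp: of_int_ceiling_le_add_one)
  then show ?thesis using assms by (simp add: dyadic_ceiling_def powr_add)
qed

text \<open>The exponents are integers, so distinct ones differ by at least \<open>1\<close>. This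
  separates steps at constant radius from steps with geometric growth.\<close>

lemma dyadic_ceiling_mono_gap:
  assumes "0 < x" "x \<le> y"
  shows "dyadic_ceiling x = dyadic_ceiling y \<or> 2 * dyadic_ceiling x \<le> dyadic_ceiling y"
proof (cases "\<lceil>log 2 x\<rceil> = \<lceil>log 2 y\<rceil>")
  case False
  have "\<lceil>log 2 x\<rceil> \<le> \<lceil>log 2 y\<rceil>"
    using assms by (intro ceiling_mono) simp
  then have "real_of_int \<lceil>log 2 x\<rceil> + 1 \<le> real_of_int \<lceil>log 2 y\<rceil>"
    using False by linarith
  then have "2 powr (real_of_int \<lceil>log 2 x\<rceil> + 1) \<le> 2 powr (real_of_int \<lceil>log 2 y\<rceil>)"
    by (intro powr_mono) auto
  then show ?thesis by (simp add: dyadic_ceiling_def powr_add)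
qed (simp add: dyadic_ceiling_def)

context normed_Rd
begin

section \<open>Distance from the starting point to a request\<close>

definition ndist :: "(nat \<Rightarrow> real) \<Rightarrow> (nat \<Rightarrow> real) set \<Rightarrow> real" where
  "ndist x0 K = (INF x \<in> K. N (\<lambda>i. x0 i - x i))"

lemma convex_body_dest:
  assumes "convex_body d K"
  shows "closed K" "K \<subseteq> Rd d" "convex_in_Rd K" "K \<noteq> {}"
  using assms by (auto simp: convex_body_def closedin_Euclidean_space_iff)

lemma bdd_below_ndist: "x0 \<in> Rd d \<Longrightarrow> K \<subseteq> Rd d \<Longrightarrow> bdd_below ((\<lambda>x. N (\<lambda>i. x0 i - x i)) ` K)"
  by (rule bdd_belowI2[where m = 0]) (auto intro!: N_nonneg Rd_lin)

lemma ndist_le: "x0 \<in> Rd d \<Longrightarrow> K \<subseteq> Rd d \<Longrightarrow> x \<in> K \<Longrightarrow> ndist x0 K \<le> N (\<lambda>i. x0 i - x i)"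
  unfolding ndist_def by (rule cINF_lower[OF bdd_below_ndist])

text \<open>Cutting \<open>K\<close> with the ball around \<open>x0\<close> through one of its
  points \<open>y\<close> leaves a compact set, and the points of \<open>K\<close> cut off are
  farther away than \<open>y\<close>.\<close>

lemma ndist_attained:
  assumes x0: "x0 \<in> Rd d" and K: "convex_body d K"
  obtains x where "x \<in> K" "N (\<lambda>i. x i - x0 i) = ndist x0 K"
proof -
  note K' = convex_body_dest[OF K]
  obtain y where y: "y \<in> K" using K' by auto
  let ?f = "\<lambda>x. N (\<lambda>i. x0 i - x i)"
  define S where "S = K \<inter> nball x0 (?f y)"
  have yS: "y \<in> S" using y K' x0 N_diff_commute[of x0 y] by (auto simp: S_def nball_def)
  obtain B where B: "\<And>x i. x \<in> nball x0 (?f y) \<Longrightarrow> i < d \<Longrightarrow> \<bar>x i\<bar> \<le> B"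
    using bounded_nball[OF x0, of "?f y"] by (auto simp: bounded_Rd_def)
  have "compact S"
  proof (rule compact_bounded_Rd[of S d B])
    show "closed S" unfolding S_def by (intro closed_Int K' closed_nball x0)
  qed (use K' B in \<open>auto simp: S_def\<close>)
  moreover have "continuous_on S ?f"
  proof (rule continuous_on_compose2[OF continuous_on_N])
    show "continuous_on S (\<lambda>x i. x0 i - x i)"
      by (intro continuous_intros continuous_on_subset[OF continuous_on_product_coordinates]) auto
  qed (use x0 K' Rd_lin in \<open>auto simp: S_def\<close>)
  ultimately obtain z where z: "z \<in> S" "\<And>x. x \<in> S \<Longrightarrow> ?f z \<le> ?f x"
    using continuous_attains_inf[of S ?f] yS by auto
  have zK: "z \<in> K" using z by (simp add: S_def)
  have min: "?f z \<le> ?f x" if "x \<in> K" for x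
  proof (cases "x \<in> S")
    case False
    then have "?f y < ?f x"
      using that K' x0 N_diff_commute[of x0 x] by (auto simp: S_def nball_def)
    then show ?thesis using z(2)[OF yS] by simp
  qed (rule z(2))
  have "?f z \<le> ndist x0 K"
    unfolding ndist_def using min K' by (intro cINF_greatest) auto
  with ndist_le[OF x0 K'(2) zK] have "?f z = ndist x0 K" by simp
  then show thesis using that[OF zK] N_diff_commute[of x0 z] x0 K' zK by auto
qed

lemma ndist_nonneg:
  assumes "x0 \<in> Rd d" "convex_body d K"
  shows "0 \<le> ndist x0 K"
  using ndist_attained[OF assms] N_nonneg[OF Rd_lin(2)[OF _ assms(1)]] convex_body_dest[OF assms(2)]
  by (metis subsetD)

lemma ndist_mono:
  assumes x0: "x0 \<in> Rd d" and "convex_body d K" "convex_body d L" "L \<subseteq> K"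
  shows "ndist x0 K \<le> ndist x0 L"
  unfolding ndist_def
  using convex_body_dest[OF assms(2)] convex_body_dest[OF assms(3)] assms(4)
  by (intro cINF_superset_mono bdd_below_ndist x0) auto

text \<open>The cut gives unbounded requests a Steiner point. Rounding the radius keeps it constant
  over long stretches, during which the localised bodies are nested.\<close>

definition localise :: "(nat \<Rightarrow> real) \<Rightarrow> (nat \<Rightarrow> real) set \<Rightarrow> (nat \<Rightarrow> real) set" where
  "localise x0 K = K \<inter> nball x0 (dyadic_ceiling (ndist x0 K))"

text \<open>At distance zero the starting point lies in the closed set \<open>K\<close>, and a
  competitive bound against offline cost \<open>0\<close> leaves no room to move.\<close>

definition select :: "(nat \<Rightarrow> real) \<Rightarrow> (nat \<Rightarrow> real) set \<Rightarrow> (nat \<Rightarrow> real)" where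
  "select x0 K = (if ndist x0 K = 0 then x0 else steiner (localise x0 K))"

text \<open>
  The factor \<open>3 * (chase_const + 1)\<close> makes the potential pay for the jump when the radius at least doubles.
\<close>

definition potential :: "(nat \<Rightarrow> real) \<Rightarrow> (nat \<Rightarrow> real) set \<Rightarrow> real" where
  "potential x0 K = (if ndist x0 K = 0 then 0
     else 3 * (chase_const + 1) * dyadic_ceiling (ndist x0 K) - energy x0 (localise x0 K))"

lemma convex_in_Rd_Int: "convex_in_Rd K \<Longrightarrow> convex_in_Rd L \<Longrightarrow> convex_in_Rd (K \<inter> L)"
  by (auto simp: convex_in_Rd_def)

lemma localise_nonempty:
  assumes x0: "x0 \<in> Rd d" and K: "convex_body d K" and pos: "ndist x0 K \<noteq> 0"
  shows "localise x0 K \<noteq> {}"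
proof -
  obtain x where x: "x \<in> K" "N (\<lambda>i. x i - x0 i) = ndist x0 K"
    using ndist_attained[OF x0 K] by blast
  have "0 < ndist x0 K" using ndist_nonneg[OF x0 K] pos by simp
  then have "x \<in> localise x0 K"
    using x convex_body_dest[OF K] dyadic_ceiling_ge[of "ndist x0 K"]
    by (auto simp: localise_def nball_def)
  then show ?thesis by auto
qed

lemma localise_subset: "localise x0 K \<subseteq> nball x0 (dyadic_ceiling (ndist x0 K))"
  by (simp add: localise_def)

lemma steiner_localise:
  assumes x0: "x0 \<in> Rd d" and K: "convex_body d K" and pos: "ndist x0 K \<noteq> 0"
  shows "steiner (localise x0 K) \<in> localise x0 K"
proof (rule steiner_in)
  note K' = convex_body_dest[OF K]
  show "closed (localise x0 K)" "convex_in_Rd (localise x0 K)" "localise x0 K \<subseteq> Rd d"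
    unfolding localise_def
    by (use K' in \<open>auto intro!: closed_Int closed_nball convex_in_Rd_Int convex_nball x0\<close>)
  show "bounded_Rd d (localise x0 K)"
    by (rule bounded_Rd_subset[OF bounded_nball[OF x0] localise_subset])
qed (rule localise_nonempty[OF assms])

lemma select_in:
  assumes x0: "x0 \<in> Rd d" and K: "convex_body d K"
  shows "select x0 K \<in> K"
proof (cases "ndist x0 K = 0")
  case True
  obtain x where x: "x \<in> K" "N (\<lambda>i. x i - x0 i) = ndist x0 K"
    using ndist_attained[OF x0 K] by blast
  then have "x \<in> Rd d" using convex_body_dest[OF K] by auto
  then have "(\<lambda>i. x i - x0 i) = (\<lambda>i. 0)"
    using N_eq_0[OF Rd_lin(2)[OF _ x0]] x True by simp
  then have "x = x0" by (metis (no_types) eq_iff_diff_eq_0 ext)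
  then show ?thesis using x True by (simp add: select_def)
next
  case False
  then show ?thesis using steiner_localise[OF assms] by (simp add: select_def localise_def)
qed

lemma N_select_le:
  assumes x0: "x0 \<in> Rd d" and K: "convex_body d K" and pos: "ndist x0 K \<noteq> 0"
  shows "N (\<lambda>i. select x0 K i - x0 i) \<le> dyadic_ceiling (ndist x0 K)"
  using steiner_localise[OF assms] pos by (simp add: select_def localise_def nball_def)

lemma abs_energy_localise:
  assumes x0: "x0 \<in> Rd d" and K: "convex_body d K" and pos: "ndist x0 K \<noteq> 0"
  shows "\<bar>energy x0 (localise x0 K)\<bar> \<le> chase_const * dyadic_ceiling (ndist x0 K)"
  by (rule abs_energy_le[OF x0 localise_subset localise_nonempty[OF assms]])
     (simp add: dyadic_ceiling_pos less_imp_le)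

text \<open>The move is at most the radius and the energy at most \<open>chase_const\<close> times
  the radius; the potential covers both. Besides the first request this handles the first departure
  from \<open>x0\<close> later on.\<close>

lemma select_first:
  assumes x0: "x0 \<in> Rd d" and K: "convex_body d K"
  shows "N (\<lambda>i. select x0 K i - x0 i) \<le> potential x0 K"
proof (cases "ndist x0 K = 0")
  case True
  then show ?thesis by (simp add: select_def potential_def N_zero)
next
  case False
  let ?R = "dyadic_ceiling (ndist x0 K)"
  have "(1 + chase_const) * ?R \<le> 3 * (chase_const + 1) * ?R"
    using chase_const_pos dyadic_ceiling_pos[of "ndist x0 K"] by (intro mult_right_mono) auto
  then show ?thesis
    using N_select_le[OF assms False] abs_energy_localise[OF assms False] False
    by (simp add: potential_def ring_distribs)
qed

text \<open>Three situations: the old request still contains \<open>x0\<close>, so this is a first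
  move; the radius is unchanged, so the localised bodies are nested and the energy pays; or the
  radius at least doubles, and the detour through \<open>x0\<close> is paid by the growth of the
  radius term.\<close>

lemma select_step:
  assumes x0: "x0 \<in> Rd d" and K: "convex_body d K" and L: "convex_body d L" "L \<subseteq> K"
  shows "N (\<lambda>i. select x0 L i - select x0 K i) \<le> potential x0 L - potential x0 K"
proof (cases "ndist x0 K = 0")
  case True
  then show ?thesis
    using select_first[OF x0 L(1)] by (simp add: select_def potential_def)
next
  case False
  have K0: "0 < ndist x0 K" using ndist_nonneg[OF x0 K] False by simp
  have KL: "ndist x0 K \<le> ndist x0 L" by (rule ndist_mono[OF x0 K L])
  then have L0: "ndist x0 L \<noteq> 0" using K0 by simp
  let ?r = "dyadic_ceiling (ndist x0 K)" and ?R = "dyadic_ceiling (ndist x0 L)"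
  consider "?r = ?R" | "2 * ?r \<le> ?R" using dyadic_ceiling_mono_gap[OF K0 KL] by blast
  then show ?thesis
  proof cases
    case 1
    have "N (\<lambda>i. steiner (localise x0 L) i - steiner (localise x0 K) i)
        \<le> energy x0 (localise x0 K) - energy x0 (localise x0 L)"
      by (rule steiner_movement[OF x0 localise_subset _ localise_nonempty[OF x0 L(1) L0]])
         (use 1 L in \<open>auto simp: localise_def\<close>)
    then show ?thesis using False L0 1 by (simp add: select_def potential_def)
  next
    case 2
    have Rd: "select x0 K \<in> Rd d" "select x0 L \<in> Rd d"
      using select_in[OF x0 K] select_in[OF x0 L(1)] convex_body_dest[OF K] L by auto
    have "N (\<lambda>i. select x0 L i - select x0 K i)
        \<le> N (\<lambda>i. select x0 L i - x0 i) + N (\<lambda>i. x0 i - select x0 K i)"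
      by (rule N_diff_triangle[OF Rd(2) x0 Rd(1)])
    also have "\<dots> \<le> ?R + ?r"
      using N_select_le[OF x0 L(1) L0] N_select_le[OF x0 K False] N_diff_commute[OF x0 Rd(1)]
      by linarith
    also have "\<dots> \<le> 3 * (chase_const + 1) * (?R - ?r) - chase_const * ?R - chase_const * ?r"
    proof -
      \<comment> \<open>With the factor \<open>3\<close> in the potential the required inequality is
        exactly \<open>2 * ?r \<le> ?R\<close> multiplied by
        \<open>2 * chase_const + 2\<close>.\<close>
      have "(4 * chase_const + 4) * ?r \<le> (2 * chase_const + 2) * ?R"
        using mult_left_mono[OF 2, of "2 * chase_const + 2"] chase_const_pos by (simp add: algebra_simps)
      then show ?thesis by (simp add: algebra_simps)
    qed
    also have "\<dots> \<le> potential x0 L - potential x0 K"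
      using abs_energy_localise[OF x0 L(1) L0] abs_energy_localise[OF x0 K False] False L0
      by (simp add: potential_def algebra_simps)
    finally show ?thesis .
  qed
qed

text \<open>The energy adds at most one more \<open>chase_const\<close> to the radius term, and
  rounding loses at most a factor \<open>2\<close>.\<close>

lemma potential_le:
  assumes x0: "x0 \<in> Rd d" and K: "convex_body d K"
  shows "potential x0 K \<le> (8 * chase_const + 6) * ndist x0 K"
proof (cases "ndist x0 K = 0")
  case False
  then have K0: "0 < ndist x0 K" using ndist_nonneg[OF x0 K] by simp
  have "potential x0 K \<le> (4 * chase_const + 3) * dyadic_ceiling (ndist x0 K)"
    using abs_energy_localise[OF assms False] False by (simp add: potential_def algebra_simps)
  also have "\<dots> \<le> (4 * chase_const + 3) * (2 * ndist x0 K)"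
    using chase_const_pos dyadic_ceiling_le[OF K0] by (intro mult_left_mono) auto
  finally show ?thesis by (simp add: algebra_simps)
qed (simp add: potential_def)

section \<open>The online algorithm and its competitive ratio\<close>

definition alg :: chasing_algorithm where
  "alg x0 Ks = select x0 (last Ks)"

lemma online_alg: "online_algorithm d alg"
  unfolding online_algorithm_def alg_def nested_requests_def
  by (auto intro!: select_in)

text \<open>Telescoping of the potential, by induction on the number of steps. The position at time
  \<open>t\<close> answers the request \<open>Ks ! (t - 1)\<close>, which explains the shifted
  index.\<close>

lemma cost_le_potential:
  assumes x0: "x0 \<in> Rd d" and Ks: "nested_requests d Ks" and n: "1 \<le> n" "n \<le> length Ks"
  shows "(\<Sum>t = 1..n. N (\<lambda>i. position alg x0 Ks t i - position alg x0 Ks (t - 1) i))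
    \<le> potential x0 (Ks ! (n - 1))"
proof -
  have pos: "position alg x0 Ks (Suc m) = select x0 (Ks ! m)" if "m < length Ks" for m
    using that by (simp add: position_def alg_def take_Suc_conv_app_nth)
  have body: "convex_body d (Ks ! m)" if "m < length Ks" for m
    using Ks that by (simp add: nested_requests_def)
  show ?thesis using n
  proof (induction n rule: nat_induct_at_least)
    case base
    then have "0 < length Ks" by linarith
    then show ?case
      using select_first[OF x0 body] pos by (simp add: position_def[of _ _ _ 0])
  next
    case (Suc n)
    obtain m where m: "n = Suc m" using Suc.hyps by (cases n) auto
    have "Ks ! Suc m \<subseteq> Ks ! m" using Ks Suc.prems m by (simp add: nested_requests_def)
    then have "N (\<lambda>i. select x0 (Ks ! Suc m) i - select x0 (Ks ! m) i)
        \<le> potential x0 (Ks ! Suc m) - potential x0 (Ks ! m)"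
      using Suc.prems m by (intro select_step x0 body) auto
    then show ?case
      using Suc.IH Suc.prems m pos[of m] pos[of "Suc m"] by simp
  qed
qed

lemma competitive_alg: "competitive d N alg (8 * chase_const + 6)"
  unfolding competitive_def
proof (intro ballI allI impI)
  fix x0 Ks assume x0: "x0 \<in> Rd d" and Ks: "nested_requests d Ks"
  then have ne: "Ks \<noteq> []" and body: "convex_body d (last Ks)"
    by (auto simp: nested_requests_def)
  have "movement_cost N alg x0 Ks \<le> potential x0 (Ks ! (length Ks - 1))"
    unfolding movement_cost_def using ne
    by (intro cost_le_potential[OF x0 Ks]) (auto simp: Suc_le_eq)
  also have "Ks ! (length Ks - 1) = last Ks" using ne by (simp add: last_conv_nth)
  also have "potential x0 (last Ks) \<le> (8 * chase_const + 6) * offline_cost N x0 Ks"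
    using potential_le[OF x0 body] by (simp add: offline_cost_def ndist_def)
  finally show "movement_cost N alg x0 Ks \<le> (8 * chase_const + 6) * offline_cost N x0 Ks" .
qed

end

lemma linear_in_bigo_linearithmic:
  "(\<lambda>d. 8 * (2 * exp 2 * (real d + 1)) + 6) \<in> O(\<lambda>d. real d * ln (real d))"
proof (rule bigoI)
  show "eventually (\<lambda>d. norm (8 * (2 * exp 2 * (real d + 1)) + 6) \<le> (32 * exp 2 + 6) * norm (real d * ln (real d))) at_top"
    \<comment> \<open>From \<open>3\<close> on, \<open>real d\<close> is at least
      \<open>exp 1\<close>, so \<open>ln (real d)\<close> is at least \<open>1\<close> and
      multiplying by it only increases the bound.\<close>
    using eventually_ge_at_top[of 3]
  proof (rule eventually_mono)
    fix d :: nat assume d: "3 \<le> d"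
    have "exp 1 \<le> real d" using exp_le d by linarith
    then have ln: "1 \<le> ln (real d)" using d by (subst ln_ge_iff) auto
    have "8 * (2 * exp 2 * (real d + 1)) + 6 \<le> (32 * exp 2 + 6) * real d"
    proof -
      have "exp 2 * 1 \<le> exp 2 * real d" using d by (intro mult_left_mono) auto
      then have "16 * exp 2 + 6 \<le> (16 * exp 2) * real d + 6 * real d" using d by linarith
      then show ?thesis by (simp add: algebra_simps)
    qed
    also have "\<dots> \<le> (32 * exp 2 + 6) * (real d * ln (real d))"
      using ln d by (intro mult_left_mono) auto
    finally show "norm (8 * (2 * exp 2 * (real d + 1)) + 6) \<le> (32 * exp 2 + 6) * norm (real d * ln (real d))"
      using ln d by (simp add: abs_mult)
  qed
qed

theorem theorem1:
  "\<exists>f :: nat \<Rightarrow> real. f \<in> O(\<lambda>d. real d * ln (real d)) \<and>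
     (\<forall>d \<ge> 1. \<forall>N. norm_on_Rd d N \<longrightarrow>
        (\<exists>A. online_algorithm d A \<and> competitive d N A (f d)))"
proof (intro exI conjI allI impI)
  \<comment> \<open>The witness is \<open>8 * chase_const + 6\<close> written out, because
    \<open>chase_const\<close> lives inside the locale while the function has to be fixed before
    \<open>d\<close> and \<open>N\<close>.\<close>
  show "(\<lambda>d. 8 * (2 * exp 2 * (real d + 1)) + 6) \<in> O(\<lambda>d. real d * ln (real d))"
    by (rule linear_in_bigo_linearithmic)
  fix d :: nat and N assume "1 \<le> d" "norm_on_Rd d N"
  then interpret normed_Rd d N by unfold_locales
  show "online_algorithm d alg" by (rule online_alg)
  show "competitive d N alg (8 * (2 * exp 2 * (real d + 1)) + 6)"
    using competitive_alg by (simp only: chase_const_def)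
qed

end
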